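(* Let $A=\mathbb{C}_\lambda[S^2]$ be the unit fuzzy sphere with its 3D differential calculus with central basis $s^1,s^2,s^3$, and let $\mathcal{S}=A^2P$ be the left $A$-module defined by the projector $$P=\tfrac12\begin{pmatrix}1+\lambda_p-x_3 & x_1+\imath x_2\\ x_1-\imath x_2 & 1+\lambda_p+x_3\end{pmatrix}\in M_2(A),$$ with generators $e^1=(1,0)P$ and $e^2=(0,1)P$. Then the Grassmann connection $\nabla_{\mathcal{S}}:\mathcal{S}\to\Omega^1\otimes_A\mathcal{S}$, $\nabla_{\mathcal{S}}e^\alpha=(\mathrm{d}P_{\alpha\beta})P_{\beta\gamma}\otimes e^\gamma$, is $$\nabla_{\mathcal{S}}e^\alpha=\left(\frac{1+\lambda_p}{2}\,\mathrm{d}P_{\alpha\beta}+\lambda_pP_{\alpha\beta}\theta+\imath\,\frac{1-\lambda_p^2}{4}Q_{\alpha\beta}-\frac{\lambda_p(1-\lambda_p)}{2}\delta_{\alpha\beta}\theta\right)\otimes e^\beta,$$ where $$Q=\begin{pmatrix}-s^3 & s^1+\imath s^2\\ s^1-\imath s^2 & s^3\end{pmatrix},\qquad \theta=\tfrac{1}{2\imath\lambda_p}x_is^i .$$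
   Context: Repeated Latin indices in $\{1,2,3\}$ and Greek indices in $\{1,2\}$ are summed; $\epsilon_{ijk}$ is the totally antisymmetric symbol with $\epsilon_{123}=1$; $\imath=\sqrt{-1}$; $\lambda_p$ is a real parameter with $\lambda_p\neq0,\pm1$. Algebra. $A=\mathbb{C}_\lambda[S^2]$ is the unital $*$-algebra over $\mathbb{C}$ generated by self-adjoint $x_1,x_2,x_3$ with relations $[x_i,x_j]=2\imath\lambda_p\epsilon_{ijk}x_k$ and $\sum_i x_i^2=1-\lambda_p^2$. Calculus. $\Omega^1$ is the $A$-bimodule that is free as a left module with basis $s^1,s^2,s^3$ and with $[s^i,x_j]=0$; $\mathrm{d}:A\to\Omega^1$ is the derivation with $\mathrm{d}x_i=\epsilon_{ijk}x_js^k$. Bundle. One has $P^2=P$, and $\mathcal{S}=A^2P$ (row vectors) is the projective left $A$-module spanned over $A$ by the rows $e^1,e^2$ of $P$. A left connection on $\mathcal{S}$ is a linear map $\nabla_{\mathcal S}:\mathcal{S}\to\Omega^1\otimes_A\mathcal{S}$ with $\nabla_{\mathcal S}(as)=\mathrm{d}a\otimes s+a\nabla_{\mathcal S}s$ for $a\in A$, $s\in\mathcal{S}$. *)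

theory Defs
  imports Complex_Main "HOL-Library.Numeral_Type" "HOL-Algebra.QuotRing" "HOL-Algebra.Module"
    "HOL-Algebra.Free_Abelian_Groups"
begin

text \<open>
  The record \<^typ>\<open>('r, 'm) module\<close> carries the operations of a left module over a
  not necessarily commutative ring; its ring fields \<open>mult\<close> and \<open>one\<close> carry no information.
\<close>

record ('r, 'm) bimodule = "('r, 'm) module" +
  rsmult :: "'m \<Rightarrow> 'r \<Rightarrow> 'm" (infixl \<open>\<triangleleft>\<index>\<close> 70)

definition row_module :: "('r, 'k) ring_scheme \<Rightarrow> ('r, 'i \<Rightarrow> 'r) module" where
  "row_module R =
    \<lparr>carrier = {v. \<forall>i. v i \<in> carrier R}, monoid.mult = undefined, one = undefined,
     ring.zero = (\<lambda>i. \<zero>\<^bsub>R\<^esub>), add = (\<lambda>v w i. v i \<oplus>\<^bsub>R\<^esub> w i),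
     smult = (\<lambda>a v i. a \<otimes>\<^bsub>R\<^esub> v i)\<rparr>"

definition row_times ::
    "('r, 'k) ring_scheme \<Rightarrow> ('i::finite \<Rightarrow> 'r) \<Rightarrow> ('i \<Rightarrow> 'j \<Rightarrow> 'r) \<Rightarrow> 'j \<Rightarrow> 'r" where
  "row_times R v P j = (\<Oplus>\<^bsub>R\<^esub>i\<in>UNIV. v i \<otimes>\<^bsub>R\<^esub> P i j)"

definition proj_module ::
    "('r, 'k) ring_scheme \<Rightarrow> ('i::finite \<Rightarrow> 'i \<Rightarrow> 'r) \<Rightarrow> ('r, 'i \<Rightarrow> 'r) module" where
  "proj_module R P =
    (row_module R) \<lparr>carrier := (\<lambda>v. row_times R v P) ` carrier (row_module R)\<rparr>"

text \<open>
  \<open>M \<otimes>\<^sub>R N\<close> for a bimodule \<open>M\<close> and a left module \<open>N\<close>: the free abelian group on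
  \<open>M \<times> N\<close> modulo biadditivity and \<open>(m r, n) = (m, r n)\<close>, with \<open>R\<close> acting on the left of \<open>M\<close>.
  Free_Abelian_Groups is multiplicative: \<open>generate\<close> and \<open>Mod\<close> below are the subgroup generated and
  the quotient group of the group of formal integer combinations.
\<close>

definition tensor_relators ::
    "('r, 'k) ring_scheme \<Rightarrow> ('r, 'm, 'l) bimodule_scheme \<Rightarrow> ('r, 'n, 'p) module_scheme
      \<Rightarrow> ('m \<times> 'n \<Rightarrow>\<^sub>0 int) set" where
  "tensor_relators R M N =
    {frag_of (m \<oplus>\<^bsub>M\<^esub> m', n) - frag_of (m, n) - frag_of (m', n) | m m' n.
       m \<in> carrier M \<and> m' \<in> carrier M \<and> n \<in> carrier N} \<union>
    {frag_of (m, n \<oplus>\<^bsub>N\<^esub> n') - frag_of (m, n) - frag_of (m, n') | m n n'.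
       m \<in> carrier M \<and> n \<in> carrier N \<and> n' \<in> carrier N} \<union>
    {frag_of (m \<triangleleft>\<^bsub>M\<^esub> r, n) - frag_of (m, r \<odot>\<^bsub>N\<^esub> n) | m r n.
       m \<in> carrier M \<and> r \<in> carrier R \<and> n \<in> carrier N}"

definition tensor_kernel ::
    "('r, 'k) ring_scheme \<Rightarrow> ('r, 'm, 'l) bimodule_scheme \<Rightarrow> ('r, 'n, 'p) module_scheme
      \<Rightarrow> ('m \<times> 'n \<Rightarrow>\<^sub>0 int) set" where
  "tensor_kernel R M N =
    generate (free_Abelian_group (carrier M \<times> carrier N)) (tensor_relators R M N)"

definition tensor_class ::
    "('r, 'k) ring_scheme \<Rightarrow> ('r, 'm, 'l) bimodule_scheme \<Rightarrow> ('r, 'n, 'p) module_scheme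
      \<Rightarrow> ('m \<times> 'n \<Rightarrow>\<^sub>0 int) \<Rightarrow> ('m \<times> 'n \<Rightarrow>\<^sub>0 int) set" where
  "tensor_class R M N u =
    tensor_kernel R M N #>\<^bsub>free_Abelian_group (carrier M \<times> carrier N)\<^esub> u"

definition tensor_module ::
    "('r, 'k) ring_scheme \<Rightarrow> ('r, 'm, 'l) bimodule_scheme \<Rightarrow> ('r, 'n, 'p) module_scheme
      \<Rightarrow> ('r, ('m \<times> 'n \<Rightarrow>\<^sub>0 int) set) module" where
  "tensor_module R M N =
    (let Q = free_Abelian_group (carrier M \<times> carrier N) Mod tensor_kernel R M N in
     \<lparr>carrier = carrier Q, monoid.mult = undefined, one = undefined,
      ring.zero = one Q, add = monoid.mult Q,
      smult = (\<lambda>a X. \<Union>u\<in>X. tensor_class R M N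
                 (frag_extend (\<lambda>(m, n). frag_of (a \<odot>\<^bsub>M\<^esub> m, n)) u))\<rparr>)"

definition pure_tensor ::
    "('r, 'k) ring_scheme \<Rightarrow> ('r, 'm, 'l) bimodule_scheme \<Rightarrow> ('r, 'n, 'p) module_scheme
      \<Rightarrow> 'm \<Rightarrow> 'n \<Rightarrow> ('m \<times> 'n \<Rightarrow>\<^sub>0 int) set" where
  "pure_tensor R M N m n = tensor_class R M N (frag_of (m, n))"

text \<open>
  The ground field enters through its unit map \<open>c :: complex \<Rightarrow> 'r\<close> into \<open>R\<close>.
  Membership in \<open>\<rightarrow>\<^sub>E\<close> fixes the irrelevant values outside the domain.
\<close>

definition complex_linear_maps ::
    "(complex \<Rightarrow> 'r) \<Rightarrow> ('r, 'm, 'l) module_scheme \<Rightarrow> ('r, 'n, 'p) module_scheme \<Rightarrow> ('m \<Rightarrow> 'n) set" where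
  "complex_linear_maps c M N =
    {f \<in> carrier M \<rightarrow>\<^sub>E carrier N.
      (\<forall>x\<in>carrier M. \<forall>y\<in>carrier M. f (x \<oplus>\<^bsub>M\<^esub> y) = f x \<oplus>\<^bsub>N\<^esub> f y) \<and>
      (\<forall>z. \<forall>x\<in>carrier M. f (c z \<odot>\<^bsub>M\<^esub> x) = c z \<odot>\<^bsub>N\<^esub> f x)}"

definition regular_module :: "('r, 'k) ring_scheme \<Rightarrow> ('r, 'r) module" where
  "regular_module R =
    \<lparr>carrier = carrier R, monoid.mult = undefined, one = undefined,
     ring.zero = \<zero>\<^bsub>R\<^esub>, add = add R, smult = monoid.mult R\<rparr>"

definition derivations ::
    "(complex \<Rightarrow> 'r) \<Rightarrow> ('r, 'k) ring_scheme \<Rightarrow> ('r, 'm, 'l) bimodule_scheme \<Rightarrow> ('r \<Rightarrow> 'm) set" where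
  "derivations c R M =
    {d \<in> complex_linear_maps c (regular_module R) M.
      \<forall>a\<in>carrier R. \<forall>b\<in>carrier R. d (a \<otimes>\<^bsub>R\<^esub> b) = d a \<triangleleft>\<^bsub>M\<^esub> b \<oplus>\<^bsub>M\<^esub> a \<odot>\<^bsub>M\<^esub> d b}"

definition left_connections ::
    "(complex \<Rightarrow> 'r) \<Rightarrow> ('r, 'k) ring_scheme \<Rightarrow> ('r, 'm, 'l) bimodule_scheme \<Rightarrow> ('r \<Rightarrow> 'm)
      \<Rightarrow> ('r, 'n, 'p) module_scheme \<Rightarrow> ('n \<Rightarrow> ('m \<times> 'n \<Rightarrow>\<^sub>0 int) set) set" where
  "left_connections c R M d N =
    {D \<in> complex_linear_maps c N (tensor_module R M N).
      \<forall>a\<in>carrier R. \<forall>s\<in>carrier N.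
        D (a \<odot>\<^bsub>N\<^esub> s) =
          pure_tensor R M N (d a) s \<oplus>\<^bsub>tensor_module R M N\<^esub> a \<odot>\<^bsub>tensor_module R M N\<^esub> D s}"

text \<open>
  Finitely supported functions on the free monoid \<open>word\<close>, with the convolution product of
  \<^typ>\<open>'a \<Rightarrow>\<^sub>0 'b\<close>, which needs an additively written monoid.  The index set \<open>{1,2,3}\<close> is the
  three-element type \<^typ>\<open>3\<close>, in which \<open>3\<close> is distinct from \<open>1\<close> and \<open>2\<close> (and is also written \<open>0\<close>);
  likewise \<^typ>\<open>2\<close> serves for \<open>{1,2}\<close>.
\<close>

datatype word = Word (letters: "3 list")

instantiation word :: monoid_add
begin

definition zero_word :: word where "0 = Word []"

definition plus_word :: "word \<Rightarrow> word \<Rightarrow> word" where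
  "u + v = Word (letters u @ letters v)"

instance
  by standard (simp_all add: zero_word_def plus_word_def)

end

type_synonym free_alg = "word \<Rightarrow>\<^sub>0 complex"

definition gen :: "3 \<Rightarrow> free_alg" where
  "gen i = Poly_Mapping.single (Word [i]) 1"

definition scal :: "complex \<Rightarrow> free_alg" where
  "scal c = Poly_Mapping.single 0 c"

definition free_star :: "free_alg \<Rightarrow> free_alg" where
  "free_star f = (\<Sum>w\<in>Poly_Mapping.keys f.
     Poly_Mapping.single (Word (rev (letters w))) (cnj (Poly_Mapping.lookup f w)))"

definition free_ring :: "free_alg ring" where
  "free_ring = \<lparr>carrier = UNIV, monoid.mult = (*), one = 1, ring.zero = 0, add = (+)\<rparr>"

definition eps :: "3 \<Rightarrow> 3 \<Rightarrow> 3 \<Rightarrow> complex" where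
  "eps i j k =
    (if (i, j, k) \<in> {(1, 2, 3), (2, 3, 1), (3, 1, 2)} then 1
     else if (i, j, k) \<in> {(3, 2, 1), (2, 1, 3), (1, 3, 2)} then - 1
     else 0)"

definition fs_relators :: "real \<Rightarrow> free_alg set" where
  "fs_relators lam =
    {gen i * gen j - gen j * gen i - (\<Sum>k\<in>UNIV. scal (2 * \<i> * of_real lam * eps i j k) * gen k)
      | i j. True} \<union>
    {(\<Sum>i\<in>UNIV. gen i * gen i) - scal (of_real (1 - lam\<^sup>2))}"

text \<open>
  The relations present a *-algebra, hence the closure of the ideal under \<^const>\<open>free_star\<close>,
  which makes \<open>fs_star\<close> below descend to cosets.
\<close>

definition fs_ideal :: "real \<Rightarrow> free_alg set" where
  "fs_ideal lam =
    \<Inter>{I. ideal I free_ring \<and> free_star ` I \<subseteq> I \<and> fs_relators lam \<subseteq> I}"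

definition fs_alg :: "real \<Rightarrow> free_alg set ring" where
  "fs_alg lam = free_ring Quot fs_ideal lam"

definition fs_cls :: "real \<Rightarrow> free_alg \<Rightarrow> free_alg set" where
  "fs_cls lam f = fs_ideal lam +>\<^bsub>free_ring\<^esub> f"

definition fs_star :: "free_alg set \<Rightarrow> free_alg set" where
  "fs_star X = free_star ` X"

definition fs_x :: "real \<Rightarrow> 3 \<Rightarrow> free_alg set" where
  "fs_x lam i = fs_cls lam (gen i)"

definition fs_const :: "real \<Rightarrow> complex \<Rightarrow> free_alg set" where
  "fs_const lam c = fs_cls lam (scal c)"

text \<open>
  \<open>\<omega> :: 3 \<Rightarrow> A\<close> stands for \<open>\<omega> i s\<^sup>i\<close> summed over \<open>i\<close>.  As the basis elements \<open>s\<^sup>i\<close> commute with the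
  generators, hence with all of \<open>A\<close>, the right action multiplies each coefficient on the right.
\<close>

type_synonym fs_form = "3 \<Rightarrow> free_alg set"

definition fs_Omega :: "real \<Rightarrow> (free_alg set, fs_form) bimodule" where
  "fs_Omega lam =
    module.extend (row_module (fs_alg lam))
      (bimodule.fields (\<lambda>\<omega> a i. \<omega> i \<otimes>\<^bsub>fs_alg lam\<^esub> a))"

definition fs_s :: "real \<Rightarrow> 3 \<Rightarrow> fs_form" where
  "fs_s lam i = (\<lambda>j. if j = i then \<one>\<^bsub>fs_alg lam\<^esub> else \<zero>\<^bsub>fs_alg lam\<^esub>)"

definition fs_d :: "real \<Rightarrow> free_alg set \<Rightarrow> fs_form" where
  "fs_d lam = (THE d. d \<in> derivations (fs_const lam) (fs_alg lam) (fs_Omega lam) \<and>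
     (\<forall>i. d (fs_x lam i) =
        (\<Oplus>\<^bsub>fs_Omega lam\<^esub>j\<in>UNIV. \<Oplus>\<^bsub>fs_Omega lam\<^esub>k\<in>UNIV.
           fs_const lam (eps i j k) \<odot>\<^bsub>fs_Omega lam\<^esub> (fs_x lam j \<odot>\<^bsub>fs_Omega lam\<^esub> fs_s lam k))))"

definition fs_theta :: "real \<Rightarrow> fs_form" where
  "fs_theta lam =
    fs_const lam (1 / (2 * \<i> * of_real lam)) \<odot>\<^bsub>fs_Omega lam\<^esub>
      (\<Oplus>\<^bsub>fs_Omega lam\<^esub>i\<in>UNIV. fs_x lam i \<odot>\<^bsub>fs_Omega lam\<^esub> fs_s lam i)"

definition fs_P :: "real \<Rightarrow> 2 \<Rightarrow> 2 \<Rightarrow> free_alg set" where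
  "fs_P lam \<alpha> \<beta> = fs_cls lam (scal (1 / 2) *
    (if \<alpha> = 1 then
       if \<beta> = 1 then 1 + scal (of_real lam) - gen 3 else gen 1 + scal \<i> * gen 2
     else
       if \<beta> = 1 then gen 1 - scal \<i> * gen 2 else 1 + scal (of_real lam) + gen 3))"

definition fs_S :: "real \<Rightarrow> (free_alg set, 2 \<Rightarrow> free_alg set) module" where
  "fs_S lam = proj_module (fs_alg lam) (fs_P lam)"

definition fs_e :: "real \<Rightarrow> 2 \<Rightarrow> 2 \<Rightarrow> free_alg set" where
  "fs_e lam \<alpha> =
    row_times (fs_alg lam)
      (\<lambda>\<beta>. if \<beta> = \<alpha> then \<one>\<^bsub>fs_alg lam\<^esub> else \<zero>\<^bsub>fs_alg lam\<^esub>) (fs_P lam)"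

type_synonym fs_form_S = "(fs_form \<times> (2 \<Rightarrow> free_alg set) \<Rightarrow>\<^sub>0 int) set"

definition fs_Omega_S :: "real \<Rightarrow> (free_alg set, fs_form_S) module" where
  "fs_Omega_S lam = tensor_module (fs_alg lam) (fs_Omega lam) (fs_S lam)"

definition fs_tensor :: "real \<Rightarrow> fs_form \<Rightarrow> (2 \<Rightarrow> free_alg set) \<Rightarrow> fs_form_S" where
  "fs_tensor lam = pure_tensor (fs_alg lam) (fs_Omega lam) (fs_S lam)"

definition is_grassmann_connection ::
    "real \<Rightarrow> ((2 \<Rightarrow> free_alg set) \<Rightarrow> fs_form_S) \<Rightarrow> bool" where
  "is_grassmann_connection lam D \<longleftrightarrow>
    D \<in> left_connections (fs_const lam) (fs_alg lam) (fs_Omega lam) (fs_d lam) (fs_S lam) \<and>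
    (\<forall>\<alpha>. D (fs_e lam \<alpha>) =
      (\<Oplus>\<^bsub>fs_Omega_S lam\<^esub>\<beta>\<in>UNIV. \<Oplus>\<^bsub>fs_Omega_S lam\<^esub>\<gamma>\<in>UNIV.
         fs_tensor lam (fs_d lam (fs_P lam \<alpha> \<beta>) \<triangleleft>\<^bsub>fs_Omega lam\<^esub> fs_P lam \<beta> \<gamma>) (fs_e lam \<gamma>)))"

definition fs_Q :: "real \<Rightarrow> 2 \<Rightarrow> 2 \<Rightarrow> fs_form" where
  "fs_Q lam \<alpha> \<beta> =
    (if \<alpha> = 1 then
       if \<beta> = 1 then \<ominus>\<^bsub>fs_Omega lam\<^esub> fs_s lam 3
       else fs_s lam 1 \<oplus>\<^bsub>fs_Omega lam\<^esub> fs_const lam \<i> \<odot>\<^bsub>fs_Omega lam\<^esub> fs_s lam 2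
     else
       if \<beta> = 1 then fs_s lam 1 \<ominus>\<^bsub>fs_Omega lam\<^esub> fs_const lam \<i> \<odot>\<^bsub>fs_Omega lam\<^esub> fs_s lam 2
       else fs_s lam 3)"

end

theory Submission
  imports Defs "HOL-Analysis.Cartesian_Space"
begin

text \<open>
  For \<open>P = P\<^sup>2\<close> the Grassmann connection is \<open>v \<mapsto> \<Sum>\<^sub>i d v\<^sub>i \<otimes> e\<^sup>i\<close> for any derivation \<open>d\<close>; a connection is
  determined by its values on the rows \<open>e\<^sup>i\<close> of \<open>P\<close> because \<open>v = \<Sum>\<^sub>i v\<^sub>i e\<^sup>i\<close> for \<open>v\<close> in the image of \<open>P\<close>.
  On the fuzzy sphere \<open>d\<close> is the commutator with \<open>\<theta>\<close>, and the formula already holds in \<open>\<Omega>\<^sup>1\<close>, as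
  an equality of \<open>(dP) P\<close> with the stated matrix of forms.  Both this and \<open>P\<^sup>2 = P\<close> compare elements of
  degree at most two in the generators, where the relations reduce the antisymmetric part of the
  quadratic coefficients to degree one and a scalar multiple of the identity to degree zero.
\<close>

subsection \<open>Modules and bimodules\<close>

text \<open>Cancelling in the sum of \<open>f\<close> of zero with itself gives the empty case;
  additivity gives the induction step. Asking only for additivity lets it serve scalar actions, each
  argument of a pure tensor, and connections, which obey a Leibniz rule instead of linearity over
  \<open>R\<close>.\<close>

lemma additive_finsum:
  assumes "abelian_group M" and "abelian_group N" and "finite A"
    and f: "f \<in> carrier M \<rightarrow> carrier N"
    and add: "\<And>x y. x \<in> carrier M \<Longrightarrow> y \<in> carrier M \<Longrightarrow> f (x \<oplus>\<^bsub>M\<^esub> y) = f x \<oplus>\<^bsub>N\<^esub> f y"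
    and g: "g \<in> A \<rightarrow> carrier M"
  shows "f (\<Oplus>\<^bsub>M\<^esub>i\<in>A. g i) = (\<Oplus>\<^bsub>N\<^esub>i\<in>A. f (g i))"
proof -
  interpret M: abelian_group M by fact
  interpret N: abelian_group N by fact
  have f0: "f \<zero>\<^bsub>M\<^esub> = \<zero>\<^bsub>N\<^esub>"
    using add[of "\<zero>\<^bsub>M\<^esub>" "\<zero>\<^bsub>M\<^esub>"] f N.add.l_cancel_one' [of "f \<zero>\<^bsub>M\<^esub>" "f \<zero>\<^bsub>M\<^esub>"] by fastforce
  show ?thesis
    using \<open>finite A\<close> g
  proof (induction A rule: finite_induct)
    case empty
    then show ?case by (simp add: f0)
  next
    case (insert a A)
    then have "g \<in> A \<rightarrow> carrier M" "g a \<in> carrier M" by auto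
    moreover from this f have "(\<lambda>i. f (g i)) \<in> A \<rightarrow> carrier N" "f (g a) \<in> carrier N" by auto
    ultimately show ?case
      using insert by (simp add: M.finsum_insert N.finsum_insert add M.finsum_closed)
  qed
qed

lemma (in abelian_group) finsum_swap:
  assumes "finite A" and "finite B" and f: "\<And>i j. i \<in> A \<Longrightarrow> j \<in> B \<Longrightarrow> f i j \<in> carrier G"
  shows "(\<Oplus>i\<in>A. \<Oplus>j\<in>B. f i j) = (\<Oplus>j\<in>B. \<Oplus>i\<in>A. f i j)"
  using \<open>finite A\<close> f
proof (induction A rule: finite_induct)
  case empty
  then show ?case by (simp add: finsum_zero)
next
  case (insert a A)
  then have "(\<Oplus>j\<in>B. \<Oplus>i\<in>insert a A. f i j) = (\<Oplus>j\<in>B. f a j \<oplus> (\<Oplus>i\<in>A. f i j))"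
    by (intro finsum_cong') (auto simp: Pi_iff intro!: finsum_closed)
  also have "\<dots> = (\<Oplus>j\<in>B. f a j) \<oplus> (\<Oplus>j\<in>B. \<Oplus>i\<in>A. f i j)"
    using insert.prems by (intro finsum_addf) (auto intro!: finsum_closed)
  finally show ?case
    using insert by (simp add: finsum_insert finsum_closed Pi_iff)
qed

text \<open>The fuzzy sphere is noncommutative, so these are the left module axioms over an
  arbitrary ring.\<close>

locale left_module = R: ring R + M: abelian_group M
  for R (structure) and M (structure) +
  assumes smult_closed [simp]: "\<lbrakk>a \<in> carrier R; x \<in> carrier M\<rbrakk> \<Longrightarrow> a \<odot>\<^bsub>M\<^esub> x \<in> carrier M"
    and smult_l_distr: "\<lbrakk>a \<in> carrier R; b \<in> carrier R; x \<in> carrier M\<rbrakk>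
      \<Longrightarrow> (a \<oplus> b) \<odot>\<^bsub>M\<^esub> x = a \<odot>\<^bsub>M\<^esub> x \<oplus>\<^bsub>M\<^esub> b \<odot>\<^bsub>M\<^esub> x"
    and smult_r_distr: "\<lbrakk>a \<in> carrier R; x \<in> carrier M; y \<in> carrier M\<rbrakk>
      \<Longrightarrow> a \<odot>\<^bsub>M\<^esub> (x \<oplus>\<^bsub>M\<^esub> y) = a \<odot>\<^bsub>M\<^esub> x \<oplus>\<^bsub>M\<^esub> a \<odot>\<^bsub>M\<^esub> y"
    and smult_assoc: "\<lbrakk>a \<in> carrier R; b \<in> carrier R; x \<in> carrier M\<rbrakk>
      \<Longrightarrow> (a \<otimes> b) \<odot>\<^bsub>M\<^esub> x = a \<odot>\<^bsub>M\<^esub> (b \<odot>\<^bsub>M\<^esub> x)"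
    and smult_one: "x \<in> carrier M \<Longrightarrow> \<one> \<odot>\<^bsub>M\<^esub> x = x"

locale bimod = left_module R M for R (structure) and M (structure) +
  assumes rsmult_closed [simp]: "\<lbrakk>x \<in> carrier M; a \<in> carrier R\<rbrakk> \<Longrightarrow> x \<triangleleft>\<^bsub>M\<^esub> a \<in> carrier M"
    and rsmult_l_distr: "\<lbrakk>x \<in> carrier M; y \<in> carrier M; a \<in> carrier R\<rbrakk>
      \<Longrightarrow> (x \<oplus>\<^bsub>M\<^esub> y) \<triangleleft>\<^bsub>M\<^esub> a = x \<triangleleft>\<^bsub>M\<^esub> a \<oplus>\<^bsub>M\<^esub> y \<triangleleft>\<^bsub>M\<^esub> a"
    and rsmult_r_distr: "\<lbrakk>x \<in> carrier M; a \<in> carrier R; b \<in> carrier R\<rbrakk>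
      \<Longrightarrow> x \<triangleleft>\<^bsub>M\<^esub> (a \<oplus> b) = x \<triangleleft>\<^bsub>M\<^esub> a \<oplus>\<^bsub>M\<^esub> x \<triangleleft>\<^bsub>M\<^esub> b"
    and rsmult_assoc: "\<lbrakk>x \<in> carrier M; a \<in> carrier R; b \<in> carrier R\<rbrakk>
      \<Longrightarrow> x \<triangleleft>\<^bsub>M\<^esub> (a \<otimes> b) = (x \<triangleleft>\<^bsub>M\<^esub> a) \<triangleleft>\<^bsub>M\<^esub> b"
    and rsmult_one: "x \<in> carrier M \<Longrightarrow> x \<triangleleft>\<^bsub>M\<^esub> \<one> = x"
    and smult_rsmult: "\<lbrakk>a \<in> carrier R; x \<in> carrier M; b \<in> carrier R\<rbrakk>
      \<Longrightarrow> (a \<odot>\<^bsub>M\<^esub> x) \<triangleleft>\<^bsub>M\<^esub> b = a \<odot>\<^bsub>M\<^esub> (x \<triangleleft>\<^bsub>M\<^esub> b)"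

subsection \<open>Row modules\<close>

lemma row_module_simps [simp]:
  "v \<in> carrier (row_module R) \<longleftrightarrow> (\<forall>i. v i \<in> carrier R)"
  "\<zero>\<^bsub>row_module R\<^esub> = (\<lambda>i. \<zero>\<^bsub>R\<^esub>)"
  "v \<oplus>\<^bsub>row_module R\<^esub> w = (\<lambda>i. v i \<oplus>\<^bsub>R\<^esub> w i)"
  "a \<odot>\<^bsub>row_module R\<^esub> v = (\<lambda>i. a \<otimes>\<^bsub>R\<^esub> v i)"
  by (simp_all add: row_module_def)

lemma (in ring) left_module_row_module: "left_module R (row_module R)"
proof -
  have "abelian_group (row_module R)"
  proof (rule abelian_groupI)
    fix v assume "v \<in> carrier (row_module R)"
    then show "\<exists>w\<in>carrier (row_module R). w \<oplus>\<^bsub>row_module R\<^esub> v = \<zero>\<^bsub>row_module R\<^esub>"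
      by (intro bexI[of _ "\<lambda>i. \<ominus> v i"]) (auto simp: l_neg)
  qed (auto simp: a_ac)
  then show ?thesis
    by (intro left_module.intro left_module_axioms.intro ring_axioms)
      (auto simp: l_distr r_distr m_assoc)
qed

lemma (in ring) bimod_row_module:
  "bimod R (module.extend (row_module R) (bimodule.fields (\<lambda>\<omega> a i. \<omega> i \<otimes> a)))" (is "bimod R ?M")
proof -
  note [simp] = module.extend_def bimodule.fields_def row_module_def
  have "abelian_group ?M"
  proof (rule abelian_groupI)
    fix v assume "v \<in> carrier ?M"
    then show "\<exists>w\<in>carrier ?M. w \<oplus>\<^bsub>?M\<^esub> v = \<zero>\<^bsub>?M\<^esub>"
      by (intro bexI[of _ "\<lambda>i. \<ominus> v i"]) (auto simp: l_neg)
  qed (auto simp: a_ac)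
  then show ?thesis
    by (intro bimod.intro left_module.intro left_module_axioms.intro bimod_axioms.intro ring_axioms)
      (auto simp: l_distr r_distr m_assoc)
qed

lemma (in ring) row_times_closed:
  assumes "\<And>i. v i \<in> carrier R" and "\<And>i j. P i j \<in> carrier R"
  shows "row_times R v P j \<in> carrier R"
  unfolding row_times_def using assms by (intro finsum_closed) auto

lemma (in ring) row_times_add:
  assumes "\<And>i. v i \<in> carrier R" and "\<And>i. w i \<in> carrier R" and "\<And>i j. P i j \<in> carrier R"
  shows "row_times R (\<lambda>i. v i \<oplus> w i) P j = row_times R v P j \<oplus> row_times R w P j"
  using assms by (simp add: row_times_def l_distr finsum_addf Pi_iff)

lemma (in ring) row_times_smult:
  assumes "a \<in> carrier R" and "\<And>i. v i \<in> carrier R" and "\<And>i j. P i j \<in> carrier R"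
  shows "row_times R (\<lambda>i. a \<otimes> v i) P j = a \<otimes> row_times R v P j"
  using assms by (simp add: row_times_def m_assoc finsum_rdistr Pi_iff)

text \<open>Identifies the generators \<open>fs_e\<close>, given as unit rows times the projector,
  with the rows of the projector.\<close>

lemma (in ring) row_times_unit:
  assumes "\<And>i j. P i j \<in> carrier R"
  shows "row_times R (\<lambda>\<beta>. if \<beta> = \<alpha> then \<one> else \<zero>) P = P \<alpha>"
proof
  fix j
  have "row_times R (\<lambda>\<beta>. if \<beta> = \<alpha> then \<one> else \<zero>) P j = (\<Oplus>\<beta>\<in>UNIV. if \<alpha> = \<beta> then P \<beta> j else \<zero>)"
    unfolding row_times_def using assms by (intro finsum_cong') auto
  also have "\<dots> = P \<alpha> j"
    using assms by (intro finsum_singleton) auto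
  finally show "row_times R (\<lambda>\<beta>. if \<beta> = \<alpha> then \<one> else \<zero>) P j = P \<alpha> j" .
qed

text \<open>Associativity of matrix multiplication, by exchanging two finite sums. For an idempotent
  matrix it shows that the image is fixed pointwise.\<close>

lemma (in ring) row_times_row_times:
  assumes "\<And>i. v i \<in> carrier R" and P: "\<And>i j. P i j \<in> carrier R" and Q: "\<And>i j. Q i j \<in> carrier R"
  shows "row_times R (row_times R v P) Q = row_times R v (\<lambda>i. row_times R (P i) Q)"
proof
  fix j
  have "row_times R (row_times R v P) Q j = (\<Oplus>k\<in>UNIV. \<Oplus>i\<in>UNIV. v i \<otimes> P i k \<otimes> Q k j)"
    using assms by (simp add: row_times_def finsum_ldistr Pi_iff)
  also have "\<dots> = (\<Oplus>i\<in>UNIV. \<Oplus>k\<in>UNIV. v i \<otimes> P i k \<otimes> Q k j)"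
    using assms by (intro finsum_swap) auto
  also have "\<dots> = row_times R v (\<lambda>i. row_times R (P i) Q) j"
    using assms by (simp add: row_times_def finsum_rdistr Pi_iff m_assoc)
  finally show "row_times R (row_times R v P) Q j = row_times R v (\<lambda>i. row_times R (P i) Q) j" .
qed

lemma proj_module_simps [simp]:
  "carrier (proj_module R P) = (\<lambda>v. row_times R v P) ` {v. \<forall>i. v i \<in> carrier R}"
  "\<zero>\<^bsub>proj_module R P\<^esub> = (\<lambda>i. \<zero>\<^bsub>R\<^esub>)"
  "v \<oplus>\<^bsub>proj_module R P\<^esub> w = (\<lambda>i. v i \<oplus>\<^bsub>R\<^esub> w i)"
  "a \<odot>\<^bsub>proj_module R P\<^esub> v = (\<lambda>i. a \<otimes>\<^bsub>R\<^esub> v i)"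
  by (simp_all add: row_module_def proj_module_def)

text \<open>Right multiplication by \<open>P\<close> is additive and commutes with left scalars, so
  its image is a submodule of the rows.\<close>

lemma (in ring) left_module_proj_module:
  assumes P: "\<And>i j. P i j \<in> carrier R"
  shows "left_module R (proj_module R P)"
proof -
  let ?S = "proj_module R P"
  interpret row: left_module R "row_module R :: ('a, 'c \<Rightarrow> 'a) module"
    by (rule left_module_row_module)
  have mem: "v j \<in> carrier R" if "v \<in> carrier ?S" for v j
    using that P by (auto intro: row_times_closed)
  have add: "v \<oplus>\<^bsub>?S\<^esub> w \<in> carrier ?S" if "v \<in> carrier ?S" "w \<in> carrier ?S" for v w
  proof -
    from that obtain v' w' where "\<forall>i. v' i \<in> carrier R" "v = row_times R v' P"
      "\<forall>i. w' i \<in> carrier R" "w = row_times R w' P" by auto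
    then show ?thesis
      using P by (auto intro!: image_eqI[of _ _ "\<lambda>i. v' i \<oplus> w' i"] simp: row_times_add)
  qed
  have smult: "a \<odot>\<^bsub>?S\<^esub> v \<in> carrier ?S" if "a \<in> carrier R" "v \<in> carrier ?S" for a v
  proof -
    from that obtain v' where "\<forall>i. v' i \<in> carrier R" "v = row_times R v' P" by auto
    with \<open>a \<in> carrier R\<close> show ?thesis
      using P by (auto intro!: image_eqI[of _ _ "\<lambda>i. a \<otimes> v' i"] simp: row_times_smult)
  qed
  have zero: "\<zero>\<^bsub>?S\<^esub> \<in> carrier ?S"
    using P by (auto intro!: image_eqI[of _ _ "\<lambda>i. \<zero>"] simp: row_times_def finsum_zero)
  have "abelian_group ?S"
  proof (rule abelian_groupI)
    fix v assume v: "v \<in> carrier ?S"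
    \<comment> \<open>The negative is written as a multiple by minus one, so that closure under
      scalars places it in the image.\<close>
    then have "(\<lambda>i. \<ominus> \<one> \<otimes> v i) \<in> carrier ?S"
      using smult[of "\<ominus> \<one>" v] by simp
    then show "\<exists>w\<in>carrier ?S. w \<oplus>\<^bsub>?S\<^esub> v = \<zero>\<^bsub>?S\<^esub>"
      using mem[OF v] by (intro bexI) (auto simp: l_minus l_neg)
  qed (use mem add zero in \<open>auto simp: a_ac simp del: proj_module_simps(1)\<close>)
  then show ?thesis
    using mem add smult
    by (intro left_module.intro left_module_axioms.intro ring_axioms)
      (auto simp: l_distr r_distr m_assoc simp del: proj_module_simps(1))
qed

subsection \<open>Tensor products\<close>

locale tensor = M: bimod R M + N: left_module R N
  for R :: "('a, 'k) ring_scheme" (structure) and M :: "('a, 'b, 'l) bimodule_scheme"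
    and N :: "('a, 'd, 'p) module_scheme"
begin

abbreviation "F \<equiv> free_Abelian_group (carrier M \<times> carrier N)"
abbreviation "K \<equiv> tensor_kernel R M N"
abbreviation "T \<equiv> tensor_module R M N"
abbreviation "cls \<equiv> tensor_class R M N"
abbreviation "pure \<equiv> pure_tensor R M N"

text \<open>The scalar action on formal combinations, before passing to cosets: the map inside the
  union in \<open>tensor_module\<close>.\<close>

definition act :: "'a \<Rightarrow> ('b \<times> 'd \<Rightarrow>\<^sub>0 int) \<Rightarrow> 'b \<times> 'd \<Rightarrow>\<^sub>0 int" where
  "act a = frag_extend (\<lambda>(m, n). frag_of (a \<odot>\<^bsub>M\<^esub> m, n))"

sublocale F: comm_group F
  by (rule abelian_free_Abelian_group)

lemma F_add [simp]: "u \<in> carrier F \<Longrightarrow> v \<in> carrier F \<Longrightarrow> u + v \<in> carrier F"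
  using F.m_closed[of u v] by simp

lemma F_zero: "0 \<in> carrier F"
  using F.one_closed by simp

lemma F_diff [simp]: "u \<in> carrier F \<Longrightarrow> v \<in> carrier F \<Longrightarrow> u - v \<in> carrier F"
  using keys_diff[of u v] by auto

lemma F_frag [simp]: "m \<in> carrier M \<Longrightarrow> n \<in> carrier N \<Longrightarrow> frag_of (m, n) \<in> carrier F"
  by simp

declare carrier_free_Abelian_group_iff [simp del]

lemma relators_in_F: "tensor_relators R M N \<subseteq> carrier F"
  by (auto simp: tensor_relators_def)

sublocale K: normal K F
  using F.generate_is_subgroup[OF relators_in_F] F.normal_iff_subgroup
  by (simp add: tensor_kernel_def)

lemma act_simps [simp]:
  "act a (frag_of (m, n)) = frag_of (a \<odot>\<^bsub>M\<^esub> m, n)"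
  "act a (u + v) = act a u + act a v"
  "act a (u - v) = act a u - act a v"
  "act a (- u) = - act a u"
  "act a 0 = 0"
  by (simp_all add: act_def frag_extend_add frag_extend_diff frag_extend_minus)

lemma act_closed [simp]:
  assumes "a \<in> carrier R" and "u \<in> carrier F"
  shows "act a u \<in> carrier F"
proof -
  have "Poly_Mapping.keys u \<subseteq> carrier M \<times> carrier N"
    using assms by (simp add: carrier_free_Abelian_group_iff)
  then show ?thesis
    using keys_frag_extend[of "\<lambda>(m, n). frag_of (a \<odot>\<^bsub>M\<^esub> m, n)" u] assms(1)
    by (force simp: act_def carrier_free_Abelian_group_iff)
qed

lemma relatorI: "u \<in> tensor_relators R M N \<Longrightarrow> u \<in> K"
  by (simp add: tensor_kernel_def generate.incl)

text \<open>Each family of relators is stable for its own reason: the left action distributes over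
  sums in \<open>M\<close>, leaves the second factor alone, and commutes with the right
  action.\<close>

lemma act_relator:
  assumes "a \<in> carrier R" and "u \<in> tensor_relators R M N"
  shows "act a u \<in> tensor_relators R M N"
  using assms(2)[unfolded tensor_relators_def]
proof (elim UnE CollectE exE conjE)
  fix m m' n
  assume "u = frag_of (m \<oplus>\<^bsub>M\<^esub> m', n) - frag_of (m, n) - frag_of (m', n)"
    and "m \<in> carrier M" "m' \<in> carrier M" "n \<in> carrier N"
  then show "act a u \<in> tensor_relators R M N"
    unfolding tensor_relators_def using assms(1)
    by (intro UnI1 CollectI exI[of _ "a \<odot>\<^bsub>M\<^esub> m"] exI[of _ "a \<odot>\<^bsub>M\<^esub> m'"] exI[of _ n])
      (simp add: M.smult_r_distr)
next
  fix m n n'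
  assume "u = frag_of (m, n \<oplus>\<^bsub>N\<^esub> n') - frag_of (m, n) - frag_of (m, n')"
    and "m \<in> carrier M" "n \<in> carrier N" "n' \<in> carrier N"
  then show "act a u \<in> tensor_relators R M N"
    unfolding tensor_relators_def using assms(1)
    by (intro UnI1 UnI2 CollectI exI[of _ "a \<odot>\<^bsub>M\<^esub> m"] exI[of _ n] exI[of _ n']) simp
next
  fix m r n
  assume "u = frag_of (m \<triangleleft>\<^bsub>M\<^esub> r, n) - frag_of (m, r \<odot>\<^bsub>N\<^esub> n)"
    and "m \<in> carrier M" "r \<in> carrier R" "n \<in> carrier N"
  then show "act a u \<in> tensor_relators R M N"
    unfolding tensor_relators_def using assms(1)
    by (intro UnI2 CollectI exI[of _ "a \<odot>\<^bsub>M\<^esub> m"] exI[of _ r] exI[of _ n])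
      (simp add: M.smult_rsmult)
qed

text \<open>Since \<open>act a\<close> is additive and preserves the generators, induction over the
  generated subgroup applies. This is what lets the action descend to the quotient.\<close>

lemma act_kernel:
  assumes a: "a \<in> carrier R" and "u \<in> K"
  shows "act a u \<in> K"
  using assms(2) unfolding tensor_kernel_def
proof (induction rule: generate.induct)
  case one
  then show ?case using generate.one[of F] by simp
next
  case (incl h)
  then show ?case by (intro generate.incl act_relator a)
next
  case (inv h)
  then have h: "h \<in> carrier F" "act a h \<in> tensor_relators R M N" "act a h \<in> carrier F"
    using relators_in_F act_relator[OF a] by auto
  have "inv\<^bsub>F\<^esub> (act a h) = act a (inv\<^bsub>F\<^esub> h)"
    using h by (simp add: carrier_free_Abelian_group_iff)
  then show ?case
    using generate.inv[OF h(2), of F] by simp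
next
  case (eng h1 h2)
  then show ?case using generate.eng[of "act a h1" F _ "act a h2"] by simp
qed

lemma cls_eqI:
  assumes "u \<in> carrier F" and "v \<in> carrier F" and "u - v \<in> K"
  shows "cls u = cls v"
proof -
  have "u = (u - v) \<otimes>\<^bsub>F\<^esub> v" by simp
  then have "u \<in> K #>\<^bsub>F\<^esub> v"
    using assms(3) unfolding r_coset_def by blast
  then show ?thesis
    unfolding tensor_class_def
    using F.repr_independence[OF _ assms(2) K.subgroup_axioms] by metis
qed

lemma T_simps:
  "carrier T = cls ` carrier F"
  "\<zero>\<^bsub>T\<^esub> = K"
  "u \<in> carrier F \<Longrightarrow> v \<in> carrier F \<Longrightarrow> cls u \<oplus>\<^bsub>T\<^esub> cls v = cls (u + v)"
  by (auto simp: tensor_module_def Let_def tensor_class_def FactGroup_def RCOSETS_def K.rcos_sum)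

text \<open>The action on a coset is defined as a union over all its representatives. By
  \<open>act_kernel\<close> they all yield the same coset, so the union collapses to it.\<close>

lemma T_smult:
  assumes a: "a \<in> carrier R" and u: "u \<in> carrier F"
  shows "a \<odot>\<^bsub>T\<^esub> cls u = cls (act a u)"
proof -
  have "cls (act a v) = cls (act a u)" if "v \<in> cls u" for v
  proof -
    from that obtain k where k: "k \<in> K" "v = k + u"
      by (auto simp: tensor_class_def r_coset_def)
    then have "v \<in> carrier F" "v - u \<in> K"
      using u K.mem_carrier by auto
    then show ?thesis
      using a u act_kernel[of a "v - u"] by (intro cls_eqI) auto
  qed
  \<comment> \<open>The union must range over a nonempty set for the collapse.\<close>
  moreover have "u \<in> cls u"
    unfolding tensor_class_def by (intro F.rcos_self u K.subgroup_axioms)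
  ultimately have "(\<Union>v\<in>cls u. cls (act a v)) = cls (act a u)" by blast
  then show ?thesis
    by (simp add: tensor_module_def Let_def act_def)
qed

lemma zero_T: "\<zero>\<^bsub>T\<^esub> = cls 0"
  using F.coset_mult_one[OF K.subset] by (simp add: T_simps(2) tensor_class_def)

sublocale T: abelian_group T
proof (rule abelian_groupI)
  fix x assume "x \<in> carrier T"
  then obtain u where u: "u \<in> carrier F" "x = cls u" by (auto simp: T_simps(1))
  then have "- u \<in> carrier F" by (simp add: carrier_free_Abelian_group_iff)
  with u show "\<exists>y\<in>carrier T. y \<oplus>\<^bsub>T\<^esub> x = \<zero>\<^bsub>T\<^esub>"
    by (intro bexI[of _ "cls (- u)"]) (simp_all add: T_simps(1,3) zero_T)
qed (auto simp: T_simps(1,3) zero_T F_zero add_ac)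

lemma smult_closed [simp]: "a \<in> carrier R \<Longrightarrow> x \<in> carrier T \<Longrightarrow> a \<odot>\<^bsub>T\<^esub> x \<in> carrier T"
  by (auto simp: T_simps(1) T_smult)

lemma smult_add:
  assumes "a \<in> carrier R" and "x \<in> carrier T" and "y \<in> carrier T"
  shows "a \<odot>\<^bsub>T\<^esub> (x \<oplus>\<^bsub>T\<^esub> y) = a \<odot>\<^bsub>T\<^esub> x \<oplus>\<^bsub>T\<^esub> a \<odot>\<^bsub>T\<^esub> y"
proof -
  from assms obtain u v where "u \<in> carrier F" "v \<in> carrier F" "x = cls u" "y = cls v"
    by (auto simp: T_simps(1))
  with \<open>a \<in> carrier R\<close> show ?thesis by (simp add: T_simps(3) T_smult)
qed

lemma smult_finsum:
  assumes "finite A" and "a \<in> carrier R" and "f \<in> A \<rightarrow> carrier T"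
  shows "a \<odot>\<^bsub>T\<^esub> (\<Oplus>\<^bsub>T\<^esub>i\<in>A. f i) = (\<Oplus>\<^bsub>T\<^esub>i\<in>A. a \<odot>\<^bsub>T\<^esub> f i)"
  using assms
  by (intro additive_finsum[of T T A "\<lambda>x. a \<odot>\<^bsub>T\<^esub> x"] T.abelian_group_axioms) (auto simp: smult_add)

lemma pure_closed [simp]: "m \<in> carrier M \<Longrightarrow> n \<in> carrier N \<Longrightarrow> pure m n \<in> carrier T"
  by (simp add: pure_tensor_def T_simps(1))

lemma smult_pure:
  "a \<in> carrier R \<Longrightarrow> m \<in> carrier M \<Longrightarrow> n \<in> carrier N \<Longrightarrow> a \<odot>\<^bsub>T\<^esub> pure m n = pure (a \<odot>\<^bsub>M\<^esub> m) n"
  by (simp add: pure_tensor_def T_smult)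

lemma pure_add_left:
  assumes "m \<in> carrier M" and "m' \<in> carrier M" and "n \<in> carrier N"
  shows "pure (m \<oplus>\<^bsub>M\<^esub> m') n = pure m n \<oplus>\<^bsub>T\<^esub> pure m' n"
proof -
  have "frag_of (m \<oplus>\<^bsub>M\<^esub> m', n) - frag_of (m, n) - frag_of (m', n) \<in> K"
    using assms by (intro relatorI) (auto simp: tensor_relators_def)
  then show ?thesis
    using assms
    by (simp add: pure_tensor_def T_simps(3), intro cls_eqI) (simp_all add: diff_diff_add)
qed

lemma pure_add_right:
  assumes "m \<in> carrier M" and "n \<in> carrier N" and "n' \<in> carrier N"
  shows "pure m (n \<oplus>\<^bsub>N\<^esub> n') = pure m n \<oplus>\<^bsub>T\<^esub> pure m n'"
proof -
  have "frag_of (m, n \<oplus>\<^bsub>N\<^esub> n') - frag_of (m, n) - frag_of (m, n') \<in> K"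
    using assms by (intro relatorI) (auto simp: tensor_relators_def)
  then show ?thesis
    using assms
    by (simp add: pure_tensor_def T_simps(3), intro cls_eqI) (simp_all add: diff_diff_add)
qed

lemma pure_balanced:
  assumes "m \<in> carrier M" and "r \<in> carrier R" and "n \<in> carrier N"
  shows "pure (m \<triangleleft>\<^bsub>M\<^esub> r) n = pure m (r \<odot>\<^bsub>N\<^esub> n)"
proof -
  have "frag_of (m \<triangleleft>\<^bsub>M\<^esub> r, n) - frag_of (m, r \<odot>\<^bsub>N\<^esub> n) \<in> K"
    using assms by (intro relatorI) (auto simp: tensor_relators_def)
  then show ?thesis
    unfolding pure_tensor_def using assms by (intro cls_eqI) simp_all
qed

lemma pure_finsum_left:
  assumes "finite A" and "f \<in> A \<rightarrow> carrier M" and "n \<in> carrier N"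
  shows "pure (\<Oplus>\<^bsub>M\<^esub>i\<in>A. f i) n = (\<Oplus>\<^bsub>T\<^esub>i\<in>A. pure (f i) n)"
  using assms
  by (intro additive_finsum[of M T A "\<lambda>m. pure m n"] T.abelian_group_axioms
      M.M.abelian_group_axioms) (auto simp: pure_add_left)

lemma pure_finsum_right:
  assumes "finite A" and "f \<in> A \<rightarrow> carrier N" and "m \<in> carrier M"
  shows "pure m (\<Oplus>\<^bsub>N\<^esub>i\<in>A. f i) = (\<Oplus>\<^bsub>T\<^esub>i\<in>A. pure m (f i))"
  using assms
  by (intro additive_finsum[of N T A "\<lambda>n. pure m n"] T.abelian_group_axioms
      N.M.abelian_group_axioms) (auto simp: pure_add_right)

end


subsection \<open>The Grassmann connection\<close>

text \<open>The carrier of \<open>M\<close> may be any set of functions closed under the pointwise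
  operations, so that this applies to the image of a projector and not only to all rows.\<close>

lemma (in abelian_monoid) pointwise_finsum:
  fixes M :: "('m, 'i \<Rightarrow> 'a, 'k) module_scheme"
  assumes "abelian_monoid M" and zero: "\<zero>\<^bsub>M\<^esub> = (\<lambda>i. \<zero>)"
    and add: "\<And>v w. v \<oplus>\<^bsub>M\<^esub> w = (\<lambda>i. v i \<oplus> w i)"
    and mem: "\<And>v i. v \<in> carrier M \<Longrightarrow> v i \<in> carrier G"
    and "finite A" and "f \<in> A \<rightarrow> carrier M"
  shows "(\<Oplus>\<^bsub>M\<^esub>a\<in>A. f a) = (\<lambda>i. \<Oplus>a\<in>A. f a i)"
proof -
  interpret M: abelian_monoid M by fact
  show ?thesis
    using \<open>finite A\<close> \<open>f \<in> A \<rightarrow> carrier M\<close>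
  proof (induction A rule: finite_induct)
    case empty
    then show ?case by (simp add: zero)
  next
    case (insert a A)
    then have "f \<in> A \<rightarrow> carrier M" "f a \<in> carrier M" "\<And>i. (\<lambda>a. f a i) \<in> A \<rightarrow> carrier G"
      "\<And>i. f a i \<in> carrier G"
      using mem by auto
    with insert show ?case
      by (simp add: M.finsum_insert finsum_insert add)
  qed
qed

lemma left_connectionsD:
  assumes "D \<in> left_connections c R M d N"
  shows "D \<in> carrier N \<rightarrow>\<^sub>E carrier (tensor_module R M N)"
    and "x \<in> carrier N \<Longrightarrow> y \<in> carrier N
      \<Longrightarrow> D (x \<oplus>\<^bsub>N\<^esub> y) = D x \<oplus>\<^bsub>tensor_module R M N\<^esub> D y"
    and "a \<in> carrier R \<Longrightarrow> x \<in> carrier N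
      \<Longrightarrow> D (a \<odot>\<^bsub>N\<^esub> x) =
        pure_tensor R M N (d a) x \<oplus>\<^bsub>tensor_module R M N\<^esub> a \<odot>\<^bsub>tensor_module R M N\<^esub> D x"
  using assms by (simp_all add: left_connections_def complex_linear_maps_def)

text \<open>The general setting: any ring, bimodule and derivation. The last assumption is
  \<open>P\<close> squared equal to \<open>P\<close>, read row by row.\<close>

locale grassmann = M: bimod R M
  for R :: "('a, 'k) ring_scheme" (structure) and M :: "('a, 'm, 'l) bimodule_scheme" +
  fixes c :: "complex \<Rightarrow> 'a" and d :: "'a \<Rightarrow> 'm" and P :: "'i::finite \<Rightarrow> 'i \<Rightarrow> 'a"
  assumes c_closed: "c z \<in> carrier R"
    and deriv: "d \<in> derivations c R M"
    and P_closed [simp]: "P i j \<in> carrier R"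
    and idempotent: "row_times R (P i) P = P i"
begin

abbreviation "S \<equiv> proj_module R P"

sublocale S: left_module R S
  by (rule M.R.left_module_proj_module) simp

sublocale tensor R M S ..

text \<open>If \<open>v = w P\<close> then \<open>v P = w P P = w P = v\<close>: the image of an
  idempotent is its set of fixed points.\<close>

lemma mem_S_iff: "v \<in> carrier S \<longleftrightarrow> (\<forall>i. v i \<in> carrier R) \<and> row_times R v P = v"
proof
  assume "v \<in> carrier S"
  then obtain w where w: "\<And>i. w i \<in> carrier R" "v = row_times R w P"
    by (auto simp: image_iff)
  then show "(\<forall>i. v i \<in> carrier R) \<and> row_times R v P = v"
    by (simp add: M.R.row_times_row_times idempotent M.R.row_times_closed)
next
  assume v: "(\<forall>i. v i \<in> carrier R) \<and> row_times R v P = v"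
  then have "row_times R v P \<in> carrier S"
    unfolding proj_module_simps by blast
  with v show "v \<in> carrier S" by metis
qed

declare proj_module_simps(1) [simp del]

lemma row_P_in_S [simp]: "P i \<in> carrier S"
  by (simp add: mem_S_iff idempotent)

lemma S_mem: "v \<in> carrier S \<Longrightarrow> v i \<in> carrier R"
  by (simp add: mem_S_iff)

text \<open>The equation \<open>v = v P\<close> read as a combination of the rows of
  \<open>P\<close>: the coefficients are the entries of \<open>v\<close> itself.\<close>

lemma S_expand:
  assumes "v \<in> carrier S"
  shows "v = (\<Oplus>\<^bsub>S\<^esub>i\<in>UNIV. v i \<odot>\<^bsub>S\<^esub> P i)"
proof -
  have "(\<Oplus>\<^bsub>S\<^esub>i\<in>UNIV. v i \<odot>\<^bsub>S\<^esub> P i) = (\<lambda>j. \<Oplus>i\<in>UNIV. (v i \<odot>\<^bsub>S\<^esub> P i) j)"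
    using assms S_mem S.smult_closed[OF S_mem row_P_in_S]
    by (intro M.R.pointwise_finsum S.M.abelian_monoid_axioms)
      (auto simp del: proj_module_simps(4))
  also have "\<dots> = row_times R v P"
    by (simp add: row_times_def fun_eq_iff)
  also have "\<dots> = v"
    using assms by (simp add: mem_S_iff)
  finally show ?thesis ..
qed

lemma d_closed [simp]: "a \<in> carrier R \<Longrightarrow> d a \<in> carrier M"
  and d_add: "a \<in> carrier R \<Longrightarrow> b \<in> carrier R \<Longrightarrow> d (a \<oplus> b) = d a \<oplus>\<^bsub>M\<^esub> d b"
  and d_scale: "a \<in> carrier R \<Longrightarrow> d (c z \<otimes> a) = c z \<odot>\<^bsub>M\<^esub> d a"
  and d_mult: "a \<in> carrier R \<Longrightarrow> b \<in> carrier R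
    \<Longrightarrow> d (a \<otimes> b) = d a \<triangleleft>\<^bsub>M\<^esub> b \<oplus>\<^bsub>M\<^esub> a \<odot>\<^bsub>M\<^esub> d b"
  using deriv by (auto simp: derivations_def complex_linear_maps_def regular_module_def)

text \<open>The derivation acts on the canonical coefficients from \<open>S_expand\<close>.
  Restricting to the carrier makes the map extensional, so that uniqueness can be stated as equality
  of functions.\<close>

definition nabla :: "('i \<Rightarrow> 'a) \<Rightarrow> ('m \<times> ('i \<Rightarrow> 'a) \<Rightarrow>\<^sub>0 int) set" where
  "nabla = restrict (\<lambda>v. \<Oplus>\<^bsub>T\<^esub>i\<in>UNIV. pure (d (v i)) (P i)) (carrier S)"

text \<open>In the Leibniz rule, \<open>d (a \<otimes> v i)\<close> yields \<open>d a\<close> times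
  \<open>v i\<close> plus \<open>a\<close> times \<open>d (v i)\<close>. In the first term
  \<open>v i\<close> crosses the tensor sign, and the multiples of the rows add up to
  \<open>v\<close> by \<open>S_expand\<close>.\<close>

lemma nabla_connection: "nabla \<in> left_connections c R M d S"
proof -
  note [simp] = S_mem
  have add: "nabla (v \<oplus>\<^bsub>S\<^esub> w) = nabla v \<oplus>\<^bsub>T\<^esub> nabla w"
    if "v \<in> carrier S" "w \<in> carrier S" for v w
  proof -
    have "v \<oplus>\<^bsub>S\<^esub> w \<in> carrier S" using that by (rule S.M.a_closed)
    with that show ?thesis
      by (simp add: nabla_def d_add pure_add_left T.finsum_addf Pi_iff)
  qed
  have scale: "nabla (c z \<odot>\<^bsub>S\<^esub> v) = c z \<odot>\<^bsub>T\<^esub> nabla v" if "v \<in> carrier S" for v z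
  proof -
    have "c z \<odot>\<^bsub>S\<^esub> v \<in> carrier S" using c_closed that by (rule S.smult_closed)
    with that show ?thesis
      by (simp add: nabla_def d_scale smult_finsum c_closed Pi_iff smult_pure)
  qed
  have leibniz: "nabla (a \<odot>\<^bsub>S\<^esub> v) = pure (d a) v \<oplus>\<^bsub>T\<^esub> a \<odot>\<^bsub>T\<^esub> nabla v"
    if a: "a \<in> carrier R" and v: "v \<in> carrier S" for a v
  proof -
    have "a \<odot>\<^bsub>S\<^esub> v \<in> carrier S" using a v by (rule S.smult_closed)
    then have "nabla (a \<odot>\<^bsub>S\<^esub> v) = (\<Oplus>\<^bsub>T\<^esub>i\<in>UNIV. pure (d (a \<otimes> v i)) (P i))"
      by (simp add: nabla_def)
    also have "\<dots> = (\<Oplus>\<^bsub>T\<^esub>i\<in>UNIV. pure (d a) (v i \<odot>\<^bsub>S\<^esub> P i) \<oplus>\<^bsub>T\<^esub> a \<odot>\<^bsub>T\<^esub> pure (d (v i)) (P i))"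
      using a v by (simp add: d_mult pure_add_left smult_pure pure_balanced del: proj_module_simps)
    also have "\<dots> = (\<Oplus>\<^bsub>T\<^esub>i\<in>UNIV. pure (d a) (v i \<odot>\<^bsub>S\<^esub> P i)) \<oplus>\<^bsub>T\<^esub>
        (\<Oplus>\<^bsub>T\<^esub>i\<in>UNIV. a \<odot>\<^bsub>T\<^esub> pure (d (v i)) (P i))"
      using a v by (intro T.finsum_addf) (auto simp del: proj_module_simps)
    also have "(\<Oplus>\<^bsub>T\<^esub>i\<in>UNIV. pure (d a) (v i \<odot>\<^bsub>S\<^esub> P i)) = pure (d a) v"
      using a v S_expand[OF v]
      by (subst pure_finsum_right[symmetric]) (auto simp del: proj_module_simps)
    also have "(\<Oplus>\<^bsub>T\<^esub>i\<in>UNIV. a \<odot>\<^bsub>T\<^esub> pure (d (v i)) (P i)) = a \<odot>\<^bsub>T\<^esub> nabla v"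
      using a v by (simp add: nabla_def smult_finsum Pi_iff)
    finally show ?thesis .
  qed
  have "nabla \<in> carrier S \<rightarrow>\<^sub>E carrier T"
    by (auto simp: nabla_def intro!: T.finsum_closed)
  with add scale leibniz show ?thesis
    by (simp add: left_connections_def complex_linear_maps_def del: proj_module_simps)
qed

text \<open>Expanding \<open>v\<close> in the rows of \<open>P\<close>, additivity and the Leibniz
  rule express the value at \<open>v\<close> through \<open>d\<close> and the values at the
  rows.\<close>

lemma connection_eqI:
  assumes D: "D \<in> left_connections c R M d S" and E: "E \<in> left_connections c R M d S"
    and eq: "\<And>i. D (P i) = E (P i)"
  shows "D = E"
proof
  fix v
  have expand: "C v = (\<Oplus>\<^bsub>T\<^esub>i\<in>UNIV. pure (d (v i)) (P i) \<oplus>\<^bsub>T\<^esub> v i \<odot>\<^bsub>T\<^esub> C (P i))"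
    if C: "C \<in> left_connections c R M d S" and v: "v \<in> carrier S" for C
  proof -
    note add = left_connectionsD(2)[OF C] and leibniz = left_connectionsD(3)[OF C]
    have maps: "C \<in> carrier S \<rightarrow> carrier T"
      using left_connectionsD(1)[OF C] by (simp add: PiE_iff Pi_iff del: proj_module_simps)
    have "C v = C (\<Oplus>\<^bsub>S\<^esub>i\<in>UNIV. v i \<odot>\<^bsub>S\<^esub> P i)"
      using S_expand[OF v] by simp
    also have "\<dots> = (\<Oplus>\<^bsub>T\<^esub>i\<in>UNIV. C (v i \<odot>\<^bsub>S\<^esub> P i))"
    proof (rule additive_finsum[OF S.M.abelian_group_axioms T.abelian_group_axioms finite maps])
      show "(\<lambda>i. v i \<odot>\<^bsub>S\<^esub> P i) \<in> UNIV \<rightarrow> carrier S"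
        using S.smult_closed[OF S_mem[OF v] row_P_in_S] by blast
    qed (rule add)
    also have "\<dots> = (\<Oplus>\<^bsub>T\<^esub>i\<in>UNIV. pure (d (v i)) (P i) \<oplus>\<^bsub>T\<^esub> v i \<odot>\<^bsub>T\<^esub> C (P i))"
      by (simp add: leibniz S_mem[OF v] del: proj_module_simps)
    finally show ?thesis .
  qed
  show "D v = E v"
  proof (cases "v \<in> carrier S")
    case True
    show ?thesis unfolding expand[OF D True] expand[OF E True] eq ..
  next
    \<comment> \<open>Outside the carrier both maps are extensional and take the same default
      value.\<close>
    case False
    show ?thesis
      using PiE_arb[OF left_connectionsD(1)[OF D] False] PiE_arb[OF left_connectionsD(1)[OF E] False]
      by (rule trans[OF _ sym])
  qed
qed

text \<open>Moving \<open>P j k\<close> across the tensor sign and summing over \<open>k\<close>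
  restores row \<open>j\<close>, which reconciles \<open>nabla\<close> with the defining formula of
  the Grassmann connection.\<close>

lemma nabla_row: "nabla (P i) = (\<Oplus>\<^bsub>T\<^esub>j\<in>UNIV. \<Oplus>\<^bsub>T\<^esub>k\<in>UNIV. pure (d (P i j) \<triangleleft>\<^bsub>M\<^esub> P j k) (P k))"
proof -
  have "(\<Oplus>\<^bsub>T\<^esub>k\<in>UNIV. pure (d (P i j) \<triangleleft>\<^bsub>M\<^esub> P j k) (P k)) = pure (d (P i j)) (P j)" for j
  proof -
    have "pure (d (P i j) \<triangleleft>\<^bsub>M\<^esub> P j k) (P k) = pure (d (P i j)) (P j k \<odot>\<^bsub>S\<^esub> P k)" for k
      by (rule pure_balanced) simp_all
    then have "(\<Oplus>\<^bsub>T\<^esub>k\<in>UNIV. pure (d (P i j) \<triangleleft>\<^bsub>M\<^esub> P j k) (P k)) =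
        (\<Oplus>\<^bsub>T\<^esub>k\<in>UNIV. pure (d (P i j)) (P j k \<odot>\<^bsub>S\<^esub> P k))"
      by (simp only:)
    also have "\<dots> = pure (d (P i j)) (P j)"
      using S_expand[OF row_P_in_S, of j]
      by (subst pure_finsum_right[symmetric]) (auto simp del: proj_module_simps)
    finally show ?thesis .
  qed
  then show ?thesis by (simp add: nabla_def)
qed

text \<open>Summing over \<open>j\<close> inside the first factor isolates the matrix product of
  \<open>d P\<close> and \<open>P\<close>, so that the remaining work takes place in the bimodule,
  without tensors.\<close>

lemma nabla_row':
  "nabla (P i) = (\<Oplus>\<^bsub>T\<^esub>k\<in>UNIV. pure (\<Oplus>\<^bsub>M\<^esub>j\<in>UNIV. d (P i j) \<triangleleft>\<^bsub>M\<^esub> P j k) (P k))"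
  unfolding nabla_row by (subst T.finsum_swap) (simp_all add: pure_finsum_left Pi_iff)

text \<open>Existence and uniqueness in one equivalence: \<open>nabla\<close> satisfies the
  conditions, and its values on the rows determine a connection.\<close>

lemma grassmann_iff:
  "D \<in> left_connections c R M d S \<and>
    (\<forall>i. D (P i) = (\<Oplus>\<^bsub>T\<^esub>j\<in>UNIV. \<Oplus>\<^bsub>T\<^esub>k\<in>UNIV. pure (d (P i j) \<triangleleft>\<^bsub>M\<^esub> P j k) (P k)))
    \<longleftrightarrow> D = nabla"
proof
  assume *: "D \<in> left_connections c R M d S \<and>
    (\<forall>i. D (P i) = (\<Oplus>\<^bsub>T\<^esub>j\<in>UNIV. \<Oplus>\<^bsub>T\<^esub>k\<in>UNIV. pure (d (P i j) \<triangleleft>\<^bsub>M\<^esub> P j k) (P k)))"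
  show "D = nabla"
    by (rule connection_eqI) (use * nabla_connection in \<open>simp_all only: nabla_row\<close>)
qed (simp only: nabla_connection nabla_row simp_thms)

end

subsection \<open>The free algebra and its quotient\<close>

lemma index_neq [simp]:
  "(1::3) \<noteq> 2" "(2::3) \<noteq> 1" "(1::3) \<noteq> 3" "(3::3) \<noteq> 1" "(2::3) \<noteq> 3" "(3::3) \<noteq> 2"
  "(1::2) \<noteq> 2" "(2::2) \<noteq> 1"
  by simp_all

lemma scal_simps:
  "scal 0 = 0" "scal 1 = 1" "scal (a + b) = scal a + scal b" "scal (a - b) = scal a - scal b"
  "scal (- a) = - scal a" "scal (a * b) = scal a * scal b"
  by (simp_all add: scal_def single_add single_diff single_uminus mult_single)

lemma scal_scal: "scal a * (scal b * f) = scal (a * b) * f"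
  by (simp add: scal_simps mult.assoc)

lemma scal_sum: "scal (\<Sum>i\<in>A. f i) = (\<Sum>i\<in>A. scal (f i))"
  by (induction A rule: infinite_finite_induct) (simp_all add: scal_simps)

lemma poly_mapping_single_induct [case_names single add]:
  fixes f :: "'a \<Rightarrow>\<^sub>0 'b::comm_monoid_add"
  assumes "\<And>k v. P (Poly_Mapping.single k v)" and "\<And>f g. P f \<Longrightarrow> P g \<Longrightarrow> P (f + g)"
  shows "P f"
proof -
  have "P (\<Sum>k\<in>A. Poly_Mapping.single k (Poly_Mapping.lookup f k))" if "finite A" for A
    using that
  proof (induction A rule: finite_induct)
    case empty
    \<comment> \<open>The zero function is a single term with coefficient 0, at an arbitrary
      key.\<close>
    show ?case using assms(1)[of undefined 0] by simp
  qed (simp add: assms)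
  moreover have "f = (\<Sum>k\<in>Poly_Mapping.keys f. Poly_Mapping.single k (Poly_Mapping.lookup f k))"
    by (rule poly_mapping_eqI) (simp add: lookup_sum lookup_single when_def in_keys_iff)
  ultimately show ?thesis by (metis finite_keys)
qed

text \<open>A scalar is supported on the empty word, which is neutral for concatenation on both
  sides.\<close>

lemma scal_central: "f * scal c = scal c * f"
proof (induction f rule: poly_mapping_single_induct)
  case (single k v)
  then show ?case by (simp add: scal_def mult_single mult.commute)
next
  case (add f g)
  then show ?case by (simp add: distrib_left distrib_right)
qed

lemma free_ring_simps [simp]:
  "carrier free_ring = UNIV" "x \<otimes>\<^bsub>free_ring\<^esub> y = x * y" "\<one>\<^bsub>free_ring\<^esub> = 1"
  "\<zero>\<^bsub>free_ring\<^esub> = 0" "x \<oplus>\<^bsub>free_ring\<^esub> y = x + y"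
  by (simp_all add: free_ring_def)

interpretation free: ring free_ring
proof (rule ringI)
  show "abelian_group free_ring"
    by (rule abelian_groupI) (auto simp: add_ac intro: exI[of _ "- x" for x])
  show "monoid free_ring"
    by (rule monoidI) (auto simp: mult.assoc)
qed (auto simp: algebra_simps)

lemma free_minus [simp]: "\<ominus>\<^bsub>free_ring\<^esub> x = - x"
  by (rule free.minus_equality) auto

lemma fs_ideal: "ideal (fs_ideal lam) free_ring"
  unfolding fs_ideal_def
proof (rule free.i_Intersect)
  \<comment> \<open>An intersection of ideals is an ideal for a nonempty family; the whole ring is a
    member.\<close>
  have "UNIV \<in> {I. ideal I free_ring \<and> free_star ` I \<subseteq> I \<and> fs_relators lam \<subseteq> I}"
    using free.oneideal by simp
  then show "{I. ideal I free_ring \<and> free_star ` I \<subseteq> I \<and> fs_relators lam \<subseteq> I} \<noteq> {}" by blast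
qed auto

lemma relators_in_fs_ideal: "fs_relators lam \<subseteq> fs_ideal lam"
  unfolding fs_ideal_def by blast

interpretation A: ring_hom_ring free_ring "fs_alg lam" "fs_cls lam" for lam
proof -
  have "fs_cls lam = (+>\<^bsub>free_ring\<^esub>) (fs_ideal lam)"
    by (simp add: fs_cls_def fun_eq_iff)
  then show "ring_hom_ring free_ring (fs_alg lam) (fs_cls lam)"
    unfolding fs_alg_def using ideal.rcos_ring_hom_ring[OF fs_ideal] by simp
qed

lemma carrier_fs_alg: "carrier (fs_alg lam) = range (fs_cls lam)"
  by (auto simp: fs_alg_def FactRing_def A_RCOSETS_def RCOSETS_def a_r_coset_def fs_cls_def)

lemma fs_cls_closed [simp]: "fs_cls lam f \<in> carrier (fs_alg lam)"
  by (simp add: carrier_fs_alg)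

lemma fs_cls_simps [simp]:
  "fs_cls lam f \<oplus>\<^bsub>fs_alg lam\<^esub> fs_cls lam g = fs_cls lam (f + g)"
  "fs_cls lam f \<otimes>\<^bsub>fs_alg lam\<^esub> fs_cls lam g = fs_cls lam (f * g)"
  "\<ominus>\<^bsub>fs_alg lam\<^esub> fs_cls lam f = fs_cls lam (- f)"
  using A.hom_add[of f g] A.hom_mult[of f g] A.hom_a_inv[of f] by simp_all

lemma one_fs_alg: "\<one>\<^bsub>fs_alg lam\<^esub> = fs_cls lam 1"
  and zero_fs_alg: "\<zero>\<^bsub>fs_alg lam\<^esub> = fs_cls lam 0"
  using A.hom_one A.hom_zero by simp_all

lemma finsum_fs_cls:
  "finite A \<Longrightarrow> (\<Oplus>\<^bsub>fs_alg lam\<^esub>i\<in>A. fs_cls lam (f i)) = fs_cls lam (\<Sum>i\<in>A. f i)"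
  by (induction A rule: finite_induct) (simp_all add: zero_fs_alg A.S.finsum_insert Pi_iff)

lemma fs_cls_eqI:
  assumes "f - g \<in> fs_ideal lam"
  shows "fs_cls lam f = fs_cls lam g"
proof -
  interpret ideal "fs_ideal lam" free_ring by (rule fs_ideal)
  have "f = (f - g) \<oplus>\<^bsub>free_ring\<^esub> g" by simp
  then have "f \<in> fs_ideal lam +>\<^bsub>free_ring\<^esub> g"
    using assms unfolding a_r_coset_def' by blast
  then show ?thesis
    unfolding fs_cls_def using a_repr_independence' by simp
qed

lemma fs_ideal_add: "f \<in> fs_ideal lam \<Longrightarrow> g \<in> fs_ideal lam \<Longrightarrow> f + g \<in> fs_ideal lam"
  and fs_ideal_mult: "f \<in> fs_ideal lam \<Longrightarrow> h * f \<in> fs_ideal lam"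
  and fs_ideal_zero: "0 \<in> fs_ideal lam"
proof -
  interpret ideal "fs_ideal lam" free_ring by (rule fs_ideal)
  show "f \<in> fs_ideal lam \<Longrightarrow> g \<in> fs_ideal lam \<Longrightarrow> f + g \<in> fs_ideal lam"
    using a_closed[of f g] by simp
  show "f \<in> fs_ideal lam \<Longrightarrow> h * f \<in> fs_ideal lam"
    using I_l_closed[of f h] by simp
  show "0 \<in> fs_ideal lam"
    using additive_subgroup.zero_closed[OF additive_subgroup_axioms] by simp
qed

lemma fs_ideal_sum: "(\<And>i. i \<in> A \<Longrightarrow> f i \<in> fs_ideal lam) \<Longrightarrow> (\<Sum>i\<in>A. f i) \<in> fs_ideal lam"
  by (induction A rule: infinite_finite_induct) (auto simp: fs_ideal_zero intro: fs_ideal_add)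

subsection \<open>Quadratic elements\<close>

definition lin :: "complex \<Rightarrow> (3 \<Rightarrow> complex) \<Rightarrow> free_alg" where
  "lin c v = scal c + (\<Sum>i\<in>UNIV. scal (v i) * gen i)"

text \<open>Storing elements of degree at most two by their coefficients turns identities in the
  algebra into finite checks on complex numbers. As generators do not commute, \<open>M\<close> is
  not assumed symmetric.\<close>

definition quad :: "complex \<Rightarrow> (3 \<Rightarrow> complex) \<Rightarrow> (3 \<Rightarrow> 3 \<Rightarrow> complex) \<Rightarrow> free_alg" where
  "quad c v M = lin c v + (\<Sum>i\<in>UNIV. \<Sum>j\<in>UNIV. scal (M i j) * (gen i * gen j))"

lemma lin_quad: "lin c v = quad c v (\<lambda>_ _. 0)"
  by (simp add: quad_def scal_simps)

lemma scal_quad: "scal c = quad c (\<lambda>_. 0) (\<lambda>_ _. 0)"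
  by (simp add: quad_def lin_def scal_simps)

lemma gen_quad: "gen k = quad 0 (\<lambda>i. if i = k then 1 else 0) (\<lambda>_ _. 0)"
proof -
  have "(\<Sum>i\<in>UNIV. scal (if i = k then 1 else 0) * gen i) = (\<Sum>i\<in>UNIV. if i = k then gen i else 0)"
    by (intro sum.cong) (auto simp: scal_simps)
  then show ?thesis by (simp add: quad_def lin_def scal_simps)
qed

lemma quad_add: "quad a v M + quad b w N = quad (a + b) (\<lambda>i. v i + w i) (\<lambda>i j. M i j + N i j)"
  by (simp add: quad_def lin_def scal_simps sum.distrib algebra_simps)

lemma quad_diff: "quad a v M - quad b w N = quad (a - b) (\<lambda>i. v i - w i) (\<lambda>i j. M i j - N i j)"
  by (simp add: quad_def lin_def scal_simps sum_subtractf algebra_simps)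

lemma scal_times_quad: "scal s * quad a v M = quad (s * a) (\<lambda>i. s * v i) (\<lambda>i j. s * M i j)"
  by (simp add: quad_def lin_def scal_simps sum_distrib_left distrib_left mult.assoc)

lemma quad_sum:
  "(\<Sum>x\<in>A. quad (a x) (v x) (M x)) = quad (\<Sum>x\<in>A. a x) (\<lambda>i. \<Sum>x\<in>A. v x i) (\<lambda>i j. \<Sum>x\<in>A. M x i j)"
  by (induction A rule: infinite_finite_induct)
    (simp_all add: quad_add, simp_all add: quad_def lin_def scal_simps)

lemma quad_times_quad:
  "quad a v (\<lambda>_ _. 0) * quad b w (\<lambda>_ _. 0) = quad (a * b) (\<lambda>i. a * w i + b * v i) (\<lambda>i j. v i * w j)"
proof -
  have "(scal (v i) * gen i) * (scal (w j) * gen j) = scal (v i * w j) * (gen i * gen j)" for i j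
  proof -
    have "gen i * (scal (w j) * gen j) = scal (w j) * (gen i * gen j)"
      unfolding mult.assoc[symmetric] scal_central[of "gen i"] ..
    then show ?thesis by (simp only: mult.assoc scal_simps(6))
  qed
  then have *: "(\<Sum>i\<in>UNIV. scal (v i) * gen i) * (\<Sum>j\<in>UNIV. scal (w j) * gen j) =
      (\<Sum>i\<in>UNIV. \<Sum>j\<in>UNIV. scal (v i * w j) * (gen i * gen j))"
    by (simp add: sum_product)
  have "(\<Sum>i\<in>UNIV. scal (a * w i + b * v i) * gen i) =
      scal a * (\<Sum>i\<in>UNIV. scal (w i) * gen i) + scal b * (\<Sum>i\<in>UNIV. scal (v i) * gen i)"
    by (simp add: sum_distrib_left scal_simps distrib_right sum.distrib mult.assoc)
  then show ?thesis
    unfolding quad_def lin_def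
    by (simp add: * scal_simps(1,6) distrib_left distrib_right add_ac scal_central[of "sum _ _"])
qed

text \<open>The element equals \<open>m\<close> times the sphere relator plus
  \<open>M i j / 2\<close> times the commutation relators. The condition on \<open>M\<close> says
  that its symmetric part is \<open>m\<close> times the identity; those on \<open>c\<close> and
  \<open>v\<close> match the lower-degree terms of the relators.\<close>

lemma quad_in_fs_ideal:
  assumes M: "\<And>i j. M i j + M j i = (if i = j then 2 * m else 0)"
    and c: "c = - m * of_real (1 - lam\<^sup>2)"
    and v: "\<And>k. v k = - \<i> * of_real lam * (\<Sum>i\<in>UNIV. \<Sum>j\<in>UNIV. eps i j k * M i j)"
  shows "quad c v M \<in> fs_ideal lam"
proof -
  define R where "R i j = gen i * gen j - gen j * gen i
    - (\<Sum>k\<in>UNIV. scal (2 * \<i> * of_real lam * eps i j k) * gen k)" for i j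
  define S where "S = (\<Sum>i\<in>UNIV. gen i * gen i) - scal (of_real (1 - lam\<^sup>2))"
  let ?g = "\<lambda>i j. gen i * gen j"
  have RS: "R i j \<in> fs_ideal lam" "S \<in> fs_ideal lam" for i j
    using relators_in_fs_ideal[of lam] by (auto simp: R_def S_def fs_relators_def)
  \<comment> \<open>The half from antisymmetrising cancels the 2 in the commutation
    relation.\<close>
  have halve: "M i j / 2 * (2 * \<i> * of_real lam * eps i j k) = \<i> * of_real lam * (eps i j k * M i j)" for i j k
    by simp
  have lin: "(\<Sum>k\<in>UNIV. scal (v k) * gen k) =
      - (\<Sum>i\<in>UNIV. \<Sum>j\<in>UNIV. scal (M i j / 2) * (\<Sum>k\<in>UNIV. scal (2 * \<i> * of_real lam * eps i j k) * gen k))"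
  proof -
    have "(\<Sum>i\<in>UNIV. \<Sum>j\<in>UNIV. scal (M i j / 2) * (\<Sum>k\<in>UNIV. scal (2 * \<i> * of_real lam * eps i j k) * gen k))
      = (\<Sum>i\<in>UNIV. \<Sum>j\<in>UNIV. \<Sum>k\<in>UNIV. scal (\<i> * of_real lam * (eps i j k * M i j)) * gen k)"
      by (simp only: sum_distrib_left scal_scal halve)
    \<comment> \<open>Two exchanges bring \<open>k\<close> outermost, where the inner double sum
      becomes the coefficient \<open>v k\<close> up to sign.\<close>
    also have "\<dots> = (\<Sum>i\<in>UNIV. \<Sum>k\<in>UNIV. \<Sum>j\<in>UNIV. scal (\<i> * of_real lam * (eps i j k * M i j)) * gen k)"
      by (intro sum.cong refl sum.swap)
    also have "\<dots> = (\<Sum>k\<in>UNIV. \<Sum>i\<in>UNIV. \<Sum>j\<in>UNIV. scal (\<i> * of_real lam * (eps i j k * M i j)) * gen k)"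
      by (rule sum.swap)
    also have "\<dots> = - (\<Sum>k\<in>UNIV. scal (v k) * gen k)"
      by (simp add: v scal_sum scal_simps sum_distrib_left sum_distrib_right sum_negf mult.assoc)
    finally show ?thesis by simp
  qed
  have "(\<Sum>i\<in>UNIV. \<Sum>j\<in>UNIV. scal (M i j / 2) * ?g j i) = (\<Sum>i\<in>UNIV. \<Sum>j\<in>UNIV. scal (M j i / 2) * ?g i j)"
    by (rule sum.swap)
  moreover have "scal m * (\<Sum>i\<in>UNIV. ?g i i) =
      (\<Sum>i\<in>UNIV. \<Sum>j\<in>UNIV. scal ((M i j + M j i) / 2) * ?g i j)"
  proof -
    have "(\<Sum>j\<in>UNIV. scal ((M i j + M j i) / 2) * ?g i j) = (\<Sum>j\<in>UNIV. if i = j then scal m * ?g i i else 0)" for i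
      unfolding M by (intro sum.cong) (auto simp: scal_simps)
    then show ?thesis by (simp add: sum_distrib_left)
  qed
  \<comment> \<open>Symmetric plus antisymmetric part. Relabelling the last term by the sum exchange
    above turns the antisymmetric part into commutators.\<close>
  moreover have "scal (M i j) = scal ((M i j + M j i) / 2) + scal (M i j / 2) - scal (M j i / 2)" for i j
    by (simp add: scal_simps(3,4)[symmetric] field_simps)
  ultimately have quad: "(\<Sum>i\<in>UNIV. \<Sum>j\<in>UNIV. scal (M i j) * ?g i j) =
      scal m * (\<Sum>i\<in>UNIV. ?g i i) + (\<Sum>i\<in>UNIV. \<Sum>j\<in>UNIV. scal (M i j / 2) * (?g i j - ?g j i))"
    by (simp add: distrib_right left_diff_distrib right_diff_distrib sum.distrib sum_subtractf)
  have "quad c v M = scal m * S + (\<Sum>i\<in>UNIV. \<Sum>j\<in>UNIV. scal (M i j / 2) * R i j)"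
    unfolding quad_def lin_def quad lin c R_def S_def
    by (simp add: right_diff_distrib sum_subtractf scal_simps)
  also have "\<dots> \<in> fs_ideal lam"
    using RS by (intro fs_ideal_add fs_ideal_mult fs_ideal_sum)
  finally show ?thesis .
qed

text \<open>The criterion above applied to the difference. The multiple \<open>m\<close> is read off
  at entry (3, 3); the first assumption makes all diagonal entries of the difference equal.\<close>

lemma fs_cls_quad_eqI:
  assumes "\<And>i j. M i j + M j i - (M' i j + M' j i) = (if i = j then 2 * (M 3 3 - M' 3 3) else 0)"
    and "c' - c = (M 3 3 - M' 3 3) * of_real (1 - lam\<^sup>2)"
    and "\<And>k. v' k - v k = \<i> * of_real lam * (\<Sum>i\<in>UNIV. \<Sum>j\<in>UNIV. eps i j k * (M i j - M' i j))"
  shows "fs_cls lam (quad c v M) = fs_cls lam (quad c' v' M')"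
proof (rule fs_cls_eqI, unfold quad_diff, rule quad_in_fs_ideal)
  show "M i j - M' i j + (M j i - M' j i) = (if i = j then 2 * (M 3 3 - M' 3 3) else 0)" for i j
    using assms(1)[of i j] by (simp add: algebra_simps)
  show "c - c' = - (M 3 3 - M' 3 3) * of_real (1 - lam\<^sup>2)"
    using assms(2) by (simp add: algebra_simps)
  show "v k - v' k = - \<i> * of_real lam * (\<Sum>i\<in>UNIV. \<Sum>j\<in>UNIV. eps i j k * (M i j - M' i j))" for k
    using assms(3)[of k] by (simp add: algebra_simps)
qed


subsection \<open>The calculus\<close>

lemma fs_Omega_simps:
  "\<omega> \<in> carrier (fs_Omega lam) \<longleftrightarrow> (\<forall>i. \<omega> i \<in> carrier (fs_alg lam))"
  "\<zero>\<^bsub>fs_Omega lam\<^esub> = (\<lambda>i. \<zero>\<^bsub>fs_alg lam\<^esub>)"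
  "\<omega> \<oplus>\<^bsub>fs_Omega lam\<^esub> \<eta> = (\<lambda>i. \<omega> i \<oplus>\<^bsub>fs_alg lam\<^esub> \<eta> i)"
  "a \<odot>\<^bsub>fs_Omega lam\<^esub> \<omega> = (\<lambda>i. a \<otimes>\<^bsub>fs_alg lam\<^esub> \<omega> i)"
  "\<omega> \<triangleleft>\<^bsub>fs_Omega lam\<^esub> a = (\<lambda>i. \<omega> i \<otimes>\<^bsub>fs_alg lam\<^esub> a)"
  by (simp_all add: fs_Omega_def module.extend_def bimodule.fields_def row_module_def)

interpretation Omega: bimod "fs_alg lam" "fs_Omega lam" for lam
  unfolding fs_Omega_def by (rule A.S.bimod_row_module)

text \<open>Forms given by free-algebra representatives of their components, so that computations
  take place before the quotient.\<close>

definition form :: "real \<Rightarrow> (3 \<Rightarrow> free_alg) \<Rightarrow> fs_form" where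
  "form lam w = (\<lambda>i. fs_cls lam (w i))"

lemma form_closed [simp]: "form lam w \<in> carrier (fs_Omega lam)"
  by (simp add: form_def fs_Omega_simps)

lemma form_simps [simp]:
  "form lam v \<oplus>\<^bsub>fs_Omega lam\<^esub> form lam w = form lam (\<lambda>i. v i + w i)"
  "\<ominus>\<^bsub>fs_Omega lam\<^esub> form lam w = form lam (\<lambda>i. - w i)"
  "form lam v \<ominus>\<^bsub>fs_Omega lam\<^esub> form lam w = form lam (\<lambda>i. v i - w i)"
  "fs_cls lam a \<odot>\<^bsub>fs_Omega lam\<^esub> form lam w = form lam (\<lambda>i. a * w i)"
  "fs_const lam c \<odot>\<^bsub>fs_Omega lam\<^esub> form lam w = form lam (\<lambda>i. scal c * w i)"
  "form lam w \<triangleleft>\<^bsub>fs_Omega lam\<^esub> fs_cls lam a = form lam (\<lambda>i. w i * a)"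
proof -
  show add: "form lam v \<oplus>\<^bsub>fs_Omega lam\<^esub> form lam w = form lam (\<lambda>i. v i + w i)" for v w
    by (simp add: form_def fs_Omega_simps)
  show uminus: "\<ominus>\<^bsub>fs_Omega lam\<^esub> form lam w = form lam (\<lambda>i. - w i)" for w
    by (rule Omega.M.minus_equality) (simp_all add: add, simp add: form_def fs_Omega_simps zero_fs_alg)
  show "form lam v \<ominus>\<^bsub>fs_Omega lam\<^esub> form lam w = form lam (\<lambda>i. v i - w i)"
    by (simp add: a_minus_def add uminus)
qed (simp_all add: form_def fs_Omega_simps fs_const_def)

lemma zero_Omega: "\<zero>\<^bsub>fs_Omega lam\<^esub> = form lam (\<lambda>_. 0)"
  by (simp add: form_def fs_Omega_simps zero_fs_alg)

lemma finsum_form: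
  "finite A \<Longrightarrow> (\<Oplus>\<^bsub>fs_Omega lam\<^esub>x\<in>A. form lam (w x)) = form lam (\<lambda>i. \<Sum>x\<in>A. w x i)"
  by (induction A rule: finite_induct) (simp_all add: zero_Omega Omega.M.finsum_insert Pi_iff)

lemma fs_s_form: "fs_s lam k = form lam (\<lambda>i. if i = k then 1 else 0)"
  by (simp add: fs_s_def form_def one_fs_alg zero_fs_alg fun_eq_iff)

text \<open>Away from \<open>lam = 0\<close> the differential is the commutator with \<^const>\<open>fs_theta\<close>.\<close>

definition inner_d :: "real \<Rightarrow> free_alg \<Rightarrow> 3 \<Rightarrow> free_alg" where
  "inner_d lam f k = scal (1 / (2 * \<i> * of_real lam)) * (gen k * f - f * gen k)"

lemma eps_cycle: "eps i j k = eps j k i"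
  by (auto simp: eps_def)

lemma eps_swap: "eps i j k = - eps j i k"
  by (auto simp: eps_def)

text \<open>In a commutator with a generator the constant cancels and the quadratic coefficients are
  antisymmetric, so the relations reduce it to a linear element: the prescribed differential of the
  generators, extended linearly.\<close>

lemma form_inner_d_lin:
  assumes "lam \<noteq> 0"
  shows "form lam (inner_d lam (lin c v)) = form lam (\<lambda>k. lin 0 (\<lambda>j. \<Sum>i\<in>UNIV. v i * eps i j k))"
proof -
  let ?\<kappa> = "1 / (2 * \<i> * of_real lam) :: complex"
  have "fs_cls lam (inner_d lam (lin c v) k) = fs_cls lam (lin 0 (\<lambda>j. \<Sum>i\<in>UNIV. v i * eps i j k))" for k
  proof -
    \<comment> \<open>The deltas collapse one sum each, and the symmetries of \<open>eps\<close>
      make the two contributions agree. The factor \<open>2 * a\<close> cancels against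
      \<open>\<i> * of_real lam\<close> when \<open>a\<close> is \<open>?\<kappa>\<close>.\<close>
    have "(\<Sum>i\<in>UNIV. \<Sum>j\<in>UNIV.
        eps i j l * (a * ((if i = k then 1 else 0) * v j) - a * (v i * (if j = k then 1 else 0)))) =
        2 * a * (\<Sum>i\<in>UNIV. v i * eps i l k)" for l a
    proof -
      have "(\<Sum>i\<in>UNIV. \<Sum>j\<in>UNIV. eps i j l * (a * ((if i = k then 1 else 0) * v j))) =
          a * (\<Sum>j\<in>UNIV. eps k j l * v j)"
      proof -
        have "(\<Sum>j\<in>UNIV. eps i j l * (a * ((if i = k then 1 else 0) * v j))) =
            (if i = k then a * (\<Sum>j\<in>UNIV. eps k j l * v j) else 0)" for i
          by (simp add: sum_distrib_left mult_ac)
        then show ?thesis by simp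
      qed
      moreover have "(\<Sum>i\<in>UNIV. \<Sum>j\<in>UNIV. eps i j l * (a * (v i * (if j = k then 1 else 0)))) =
          a * (\<Sum>i\<in>UNIV. eps i k l * v i)"
      proof -
        have "eps i j l * (a * (v i * (if j = k then 1 else 0))) =
            (if j = k then a * (eps i k l * v i) else 0)" for i j
          by simp
        then show ?thesis by (simp add: sum_distrib_left)
      qed
      moreover have "eps k j l = eps j l k" "eps j k l = - eps j l k" for j
        using eps_cycle[of k j l] eps_swap[of j k l] by simp_all
      ultimately show ?thesis
        by (simp add: right_diff_distrib sum_subtractf sum_negf mult_ac)
    qed
    from this[of _ ?\<kappa>] assms show ?thesis
      unfolding inner_d_def lin_quad gen_quad quad_times_quad quad_diff scal_times_quad
      by (intro fs_cls_quad_eqI) (auto simp: right_diff_distrib)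
  qed
  then show ?thesis by (simp add: form_def)
qed

definition inner_derivation :: "real \<Rightarrow> free_alg set \<Rightarrow> fs_form" where
  "inner_derivation lam =
    restrict (\<lambda>a i. fs_const lam (1 / (2 * \<i> * of_real lam)) \<otimes>\<^bsub>fs_alg lam\<^esub>
      (fs_x lam i \<otimes>\<^bsub>fs_alg lam\<^esub> a \<ominus>\<^bsub>fs_alg lam\<^esub> a \<otimes>\<^bsub>fs_alg lam\<^esub> fs_x lam i)) (carrier (fs_alg lam))"

lemma inner_derivation_cls: "inner_derivation lam (fs_cls lam f) = form lam (inner_d lam f)"
  by (simp add: inner_derivation_def form_def inner_d_def fs_const_def fs_x_def a_minus_def)

lemma inner_derivation_in_derivations:
  "inner_derivation lam \<in> derivations (fs_const lam) (fs_alg lam) (fs_Omega lam)"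
proof -
  have add: "inner_d lam (f + g) = (\<lambda>i. inner_d lam f i + inner_d lam g i)" for f g
    by (simp add: inner_d_def fun_eq_iff algebra_simps)
  have scale: "inner_d lam (scal z * f) = (\<lambda>i. scal z * inner_d lam f i)" for z f
  proof
    fix i
    have "gen i * (scal z * f) = scal z * (gen i * f)"
      unfolding mult.assoc[symmetric] scal_central[of "gen i"] ..
    then have "inner_d lam (scal z * f) i =
        scal (1 / (2 * \<i> * of_real lam)) * (scal z * (gen i * f - f * gen i))"
      by (simp add: inner_d_def right_diff_distrib mult.assoc)
    then show "inner_d lam (scal z * f) i = scal z * inner_d lam f i"
      by (simp add: inner_d_def scal_scal mult.commute)
  qed
  have mult: "inner_d lam (f * g) = (\<lambda>i. inner_d lam f i * g + f * inner_d lam g i)" for f g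
  proof
    fix i
    let ?c = "scal (1 / (2 * \<i> * of_real lam))"
    have "f * (?c * h) = ?c * (f * h)" for h
      unfolding mult.assoc[symmetric] scal_central[of f] ..
    then show "inner_d lam (f * g) i = inner_d lam f i * g + f * inner_d lam g i"
      by (simp add: inner_d_def algebra_simps)
  qed
  have "inner_derivation lam \<in> carrier (fs_alg lam) \<rightarrow>\<^sub>E carrier (fs_Omega lam)"
  proof (rule PiE_I)
    show "inner_derivation lam a \<in> carrier (fs_Omega lam)" if "a \<in> carrier (fs_alg lam)" for a
      using that by (auto simp: carrier_fs_alg inner_derivation_cls)
  qed (simp add: inner_derivation_def)
  then show ?thesis
    unfolding derivations_def complex_linear_maps_def
    by (auto simp: regular_module_def carrier_fs_alg fs_const_def inner_derivation_cls add scale)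
      (simp add: mult)
qed

text \<open>A derivation kills 1, since the Leibniz rule doubles its value there. Values on words
  follow from those on letters by the Leibniz rule, and all others by linearity.\<close>

lemma derivation_eqI:
  assumes d: "d \<in> derivations (fs_const lam) (fs_alg lam) (fs_Omega lam)"
    and e: "e \<in> derivations (fs_const lam) (fs_alg lam) (fs_Omega lam)"
    and gen: "\<And>i. d (fs_x lam i) = e (fs_x lam i)"
  shows "d = e"
proof -
  let ?D = "derivations (fs_const lam) (fs_alg lam) (fs_Omega lam)"
  have plus: "h (fs_cls lam (f + g)) = h (fs_cls lam f) \<oplus>\<^bsub>fs_Omega lam\<^esub> h (fs_cls lam g)"
    and scale: "h (fs_cls lam (scal z * f)) = fs_const lam z \<odot>\<^bsub>fs_Omega lam\<^esub> h (fs_cls lam f)"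
    and mult: "h (fs_cls lam (f * g)) =
      h (fs_cls lam f) \<triangleleft>\<^bsub>fs_Omega lam\<^esub> fs_cls lam g
      \<oplus>\<^bsub>fs_Omega lam\<^esub> fs_cls lam f \<odot>\<^bsub>fs_Omega lam\<^esub> h (fs_cls lam g)"
    and closed: "h (fs_cls lam f) \<in> carrier (fs_Omega lam)"
    if "h \<in> ?D" for h f g z
    using that
    by (auto simp: derivations_def complex_linear_maps_def regular_module_def carrier_fs_alg fs_const_def)
  have one: "h (fs_cls lam 1) = \<zero>\<^bsub>fs_Omega lam\<^esub>" if "h \<in> ?D" for h
  proof -
    note h = closed[OF that, of 1]
    have "h (fs_cls lam 1) = h (fs_cls lam 1) \<oplus>\<^bsub>fs_Omega lam\<^esub> h (fs_cls lam 1)"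
      using mult[OF that, of 1 1] Omega.rsmult_one[OF h] Omega.smult_one[OF h]
      by (simp add: one_fs_alg)
    then show ?thesis
      using Omega.M.add.l_cancel_one'[OF h h] by simp
  qed
  have word: "d (fs_cls lam (Poly_Mapping.single (Word w) 1)) =
      e (fs_cls lam (Poly_Mapping.single (Word w) 1))" for w
  proof (induction w)
    case Nil
    have "Poly_Mapping.single (Word []) 1 = (1 :: free_alg)"
      by (simp flip: zero_word_def)
    then show ?case by (simp add: one d e)
  next
    case (Cons i w)
    have "Poly_Mapping.single (Word (i # w)) 1 = gen i * Poly_Mapping.single (Word w) 1"
      by (simp add: gen_def mult_single plus_word_def)
    then show ?case
      using Cons gen[of i] by (simp add: mult d e fs_x_def)
  qed
  have cls: "d (fs_cls lam f) = e (fs_cls lam f)" for f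
  proof (induction f rule: poly_mapping_single_induct)
    case (single k v)
    have "Poly_Mapping.single k v = scal v * Poly_Mapping.single (Word (letters k)) 1"
      by (simp add: scal_def mult_single)
    then show ?case using word[of "letters k"] by (simp add: scale d e)
  next
    case (add f g)
    then show ?case by (simp add: plus d e)
  qed
  have maps: "h \<in> carrier (fs_alg lam) \<rightarrow>\<^sub>E carrier (fs_Omega lam)" if "h \<in> ?D" for h
    using that by (simp add: derivations_def complex_linear_maps_def regular_module_def)
  show ?thesis
    by (rule PiE_ext[OF maps[OF d] maps[OF e]]) (use cls in \<open>auto simp only: carrier_fs_alg\<close>)
qed

text \<open>The definite description in \<open>fs_d\<close> needs a unique witness: the inner
  derivation has the required values on generators, and \<open>derivation_eqI\<close> excludes any
  other.\<close>

lemma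
  assumes "lam \<noteq> 0"
  shows fs_d_derivation: "fs_d lam \<in> derivations (fs_const lam) (fs_alg lam) (fs_Omega lam)"
    and fs_d_cls: "fs_d lam (fs_cls lam f) = form lam (inner_d lam f)"
proof -
  let ?D = "derivations (fs_const lam) (fs_alg lam) (fs_Omega lam)"
  let ?d = "inner_derivation lam"
  let ?v = "\<lambda>i. \<Oplus>\<^bsub>fs_Omega lam\<^esub>j\<in>UNIV. \<Oplus>\<^bsub>fs_Omega lam\<^esub>k\<in>UNIV.
    fs_const lam (eps i j k) \<odot>\<^bsub>fs_Omega lam\<^esub> (fs_x lam j \<odot>\<^bsub>fs_Omega lam\<^esub> fs_s lam k)"
  have v: "?v i = form lam (\<lambda>k. lin 0 (\<lambda>j. eps i j k))" for i
  proof -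
    have "?v i = form lam (\<lambda>l. \<Sum>j\<in>UNIV. \<Sum>k\<in>UNIV. scal (eps i j k) * (gen j * (if l = k then 1 else 0)))"
      by (simp add: fs_s_form fs_x_def finsum_form)
    also have "\<dots> = form lam (\<lambda>k. lin 0 (\<lambda>j. eps i j k))"
      by (simp add: lin_def scal_simps if_distrib[of "\<lambda>x. _ * x"] cong: if_cong)
    finally show ?thesis .
  qed
  have "?d (fs_x lam i) = ?v i" for i
  proof -
    have "gen i = lin 0 (\<lambda>j. if j = i then 1 else 0)"
      by (simp add: lin_quad gen_quad)
    then show ?thesis
      unfolding v unfolding fs_x_def inner_derivation_cls
      using form_inner_d_lin[OF assms, of 0 "\<lambda>j. if j = i then 1 else 0"]
      by (simp add: if_distrib[of "\<lambda>x. x * _"] cong: if_cong)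
  qed
  moreover have "?d \<in> ?D" by (rule inner_derivation_in_derivations)
  ultimately have "fs_d lam = ?d"
    unfolding fs_d_def by (intro the_equality) (auto intro: derivation_eqI)
  then show "fs_d lam \<in> ?D" "fs_d lam (fs_cls lam f) = form lam (inner_d lam f)"
    using \<open>?d \<in> ?D\<close> inner_derivation_cls by simp_all
qed


subsection \<open>The projector and its connection\<close>

definition P_const :: "real \<Rightarrow> 2 \<Rightarrow> 2 \<Rightarrow> complex" where
  "P_const lam \<alpha> \<beta> = (if \<alpha> = \<beta> then of_real ((1 + lam) / 2) else 0)"

text \<open>For fixed \<open>i\<close> these are half the Pauli matrices, with the signs of the
  second and third reversed.\<close>

definition P_lin :: "2 \<Rightarrow> 2 \<Rightarrow> 3 \<Rightarrow> complex" where
  "P_lin \<alpha> \<beta> i =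
    (if \<alpha> = \<beta> then (if i = 3 then (if \<alpha> = 1 then - 1 / 2 else 1 / 2) else 0)
     else if i = 1 then 1 / 2
     else if i = 2 then (if \<alpha> = 1 then \<i> / 2 else - \<i> / 2)
     else 0)"

lemma lin_eqI: "c = c' \<Longrightarrow> (\<And>i. v i = v' i) \<Longrightarrow> lin c v = lin c' v'"
  by (simp add: lin_def)

lemma scal_lin: "scal c = lin c (\<lambda>_. 0)"
  and gen_lin: "gen k = lin 0 (\<lambda>i. if i = k then 1 else 0)"
  and lin_add: "lin a v + lin b w = lin (a + b) (\<lambda>i. v i + w i)"
  and lin_diff: "lin a v - lin b w = lin (a - b) (\<lambda>i. v i - w i)"
  and scal_times_lin: "scal s * lin a v = lin (s * a) (\<lambda>i. s * v i)"
  by (simp_all add: lin_quad gen_quad scal_quad[of c] quad_add quad_diff scal_times_quad)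

lemma fs_P_lin: "fs_P lam \<alpha> \<beta> = fs_cls lam (lin (P_const lam \<alpha> \<beta>) (P_lin \<alpha> \<beta>))"
proof -
  have one: "(1 :: free_alg) = lin 1 (\<lambda>_. 0)"
    by (simp add: lin_def scal_simps)
  have i_gen: "scal \<i> * gen k = lin 0 (\<lambda>i. if i = k then \<i> else 0)" for k
    unfolding gen_lin scal_times_lin by (rule lin_eqI) auto
  show ?thesis
    unfolding fs_P_def i_gen one scal_lin[of "of_real _"] gen_lin lin_add lin_diff
      if_distrib[of "\<lambda>x. _ * x"] scal_times_lin
    using exhaust_2[of \<alpha>] exhaust_2[of \<beta>]
    by (elim disjE; simp; intro arg_cong[of _ _ "fs_cls lam"] lin_eqI)
      (auto simp: P_const_def P_lin_def add_divide_distrib)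
qed

lemma fs_P_closed: "fs_P lam \<alpha> \<beta> \<in> carrier (fs_alg lam)"
  by (simp add: fs_P_lin)

lemma eps_values:
  "eps 1 2 3 = 1" "eps 2 3 1 = 1" "eps 3 1 2 = 1" "eps 3 2 1 = - 1" "eps 2 1 3 = - 1" "eps 1 3 2 = - 1"
  "eps i i j = 0" "eps i j i = 0" "eps j i i = 0"
  by (auto simp: eps_def)

text \<open>Anticommutation of the Pauli matrices makes the symmetric quadratic part scalar, and (1
  + lam)^2/4 + (1 - lam^2)/4 = (1 + lam)/2 settles the constants. Their commutators remove the
  surplus \<open>lam\<close> from the linear coefficient 1 + lam.\<close>

lemma fs_P_idempotent: "row_times (fs_alg lam) (fs_P lam \<alpha>) (fs_P lam) = fs_P lam \<alpha>"
proof
  fix \<gamma>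
  have "fs_cls lam (\<Sum>\<beta>\<in>UNIV. lin (P_const lam \<alpha> \<beta>) (P_lin \<alpha> \<beta>)
      * lin (P_const lam \<beta> \<gamma>) (P_lin \<beta> \<gamma>)) =
    fs_cls lam (lin (P_const lam \<alpha> \<gamma>) (P_lin \<alpha> \<gamma>))"
    unfolding lin_quad quad_times_quad quad_sum
  proof (rule fs_cls_quad_eqI, goal_cases)
    case (1 i j)
    show ?case
      using exhaust_2[of \<alpha>] exhaust_2[of \<gamma>] exhaust_3[of i] exhaust_3[of j]
      by (elim disjE) (simp_all add: sum_2 P_lin_def)
  next
    case 2
    show ?case
      using exhaust_2[of \<alpha>] exhaust_2[of \<gamma>]
      by (elim disjE) (simp_all add: sum_2 P_lin_def P_const_def power2_eq_square field_simps)
  next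
    case (3 k)
    show ?case
      using exhaust_2[of \<alpha>] exhaust_2[of \<gamma>] exhaust_3[of k]
      by (elim disjE) (simp_all add: sum_2 sum_3 eps_values P_lin_def P_const_def field_simps)
  qed
  then show "row_times (fs_alg lam) (fs_P lam \<alpha>) (fs_P lam) \<gamma> = fs_P lam \<alpha> \<gamma>"
    by (simp add: row_times_def fs_P_lin finsum_fs_cls)
qed

text \<open>\<open>Q\<close> is twice the linear part of \<open>P\<close> with each generator
  replaced by the corresponding basis form.\<close>

lemma fs_Q_form: "fs_Q lam \<alpha> \<beta> = form lam (\<lambda>k. scal (2 * P_lin \<alpha> \<beta> k))"
proof -
  have "scal \<i> * (if i = k then 1 else 0) = (if i = k then scal \<i> else 0)" for i k :: 3
    by simp
  then show ?thesis
    using exhaust_2[of \<alpha>] exhaust_2[of \<beta>]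
    by (elim disjE; simp add: fs_Q_def fs_s_form; intro arg_cong[of _ _ "form lam"] ext)
      (auto simp: P_lin_def scal_simps(1,2,5))
qed

lemma fs_theta_form: "fs_theta lam = form lam (\<lambda>k. scal (1 / (2 * \<i> * of_real lam)) * gen k)"
  by (simp add: fs_theta_def fs_x_def fs_s_form finsum_form if_distrib[of "\<lambda>x. _ * x"] cong: if_cong)

lemma fs_d_P:
  assumes "lam \<noteq> 0"
  shows "fs_d lam (fs_P lam \<alpha> \<beta>) = form lam (\<lambda>k. lin 0 (\<lambda>j. \<Sum>i\<in>UNIV. P_lin \<alpha> \<beta> i * eps i j k))"
  using form_inner_d_lin[OF assms] by (simp add: fs_P_lin fs_d_cls[OF assms])

text \<open>Componentwise, both sides have degree at most two, and on the right only
  \<open>P\<close> times \<open>theta\<close> is quadratic. The quadratic criterion leaves finitely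
  many identities between coefficients; \<open>lam\<close> nonzero allows clearing the denominator
  of \<open>theta\<close>.\<close>

lemma dP_P:
  assumes "lam \<noteq> 0"
  shows "(\<Oplus>\<^bsub>fs_Omega lam\<^esub>\<beta>\<in>UNIV. fs_d lam (fs_P lam \<alpha> \<beta>) \<triangleleft>\<^bsub>fs_Omega lam\<^esub> fs_P lam \<beta> \<gamma>) =
    fs_const lam (of_real ((1 + lam) / 2)) \<odot>\<^bsub>fs_Omega lam\<^esub> fs_d lam (fs_P lam \<alpha> \<gamma>)
    \<oplus>\<^bsub>fs_Omega lam\<^esub> fs_const lam (of_real lam) \<odot>\<^bsub>fs_Omega lam\<^esub> (fs_P lam \<alpha> \<gamma> \<odot>\<^bsub>fs_Omega lam\<^esub> fs_theta lam)
    \<oplus>\<^bsub>fs_Omega lam\<^esub> fs_const lam (\<i> * of_real ((1 - lam\<^sup>2) / 4)) \<odot>\<^bsub>fs_Omega lam\<^esub> fs_Q lam \<alpha> \<gamma>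
    \<ominus>\<^bsub>fs_Omega lam\<^esub> fs_const lam (of_real (lam * (1 - lam) / 2 * (if \<alpha> = \<gamma> then 1 else 0)))
      \<odot>\<^bsub>fs_Omega lam\<^esub> fs_theta lam"
proof -
  let ?\<kappa> = "1 / (2 * \<i> * of_real lam) :: complex"
  have "fs_cls lam (\<Sum>\<beta>\<in>UNIV. lin 0 (\<lambda>j. \<Sum>i\<in>UNIV. P_lin \<alpha> \<beta> i * eps i j k)
      * lin (P_const lam \<beta> \<gamma>) (P_lin \<beta> \<gamma>)) =
    fs_cls lam (scal (of_real ((1 + lam) / 2)) * lin 0 (\<lambda>j. \<Sum>i\<in>UNIV. P_lin \<alpha> \<gamma> i * eps i j k)
      + scal (of_real lam) * (lin (P_const lam \<alpha> \<gamma>) (P_lin \<alpha> \<gamma>) * (scal ?\<kappa> * gen k))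
      + scal (\<i> * of_real ((1 - lam\<^sup>2) / 4)) * scal (2 * P_lin \<alpha> \<gamma> k)
      - scal (of_real (lam * (1 - lam) / 2 * (if \<alpha> = \<gamma> then 1 else 0))) * (scal ?\<kappa> * gen k))" for k
    \<comment> \<open>The order matters: products with scalar factors are absorbed first, and only
      then does \<open>scal_quad\<close> convert the remaining bare scalar, as it would otherwise
      rewrite those factors too.\<close>
    unfolding lin_quad gen_quad scal_times_quad mult_zero_right quad_times_quad quad_sum
    unfolding scal_times_quad scal_simps(6)[symmetric] quad_add
    unfolding scal_quad quad_add quad_diff
  proof (rule fs_cls_quad_eqI, goal_cases)
    case (1 i j)
    show ?case
      using exhaust_2[of \<alpha>] exhaust_2[of \<gamma>] exhaust_3[of i] exhaust_3[of j] exhaust_3[of k] assms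
      by (elim disjE) (simp_all add: sum_2 sum_3 eps_values P_lin_def)
  next
    case 2
    show ?case
      using exhaust_2[of \<alpha>] exhaust_2[of \<gamma>] exhaust_3[of k] assms
      by (elim disjE) (simp_all add: sum_2 sum_3 eps_values P_lin_def P_const_def power2_eq_square field_simps)
  next
    case (3 l)
    show ?case
      using exhaust_2[of \<alpha>] exhaust_2[of \<gamma>] exhaust_3[of k] exhaust_3[of l] assms
      by (elim disjE) (simp_all add: sum_2 sum_3 eps_values P_lin_def P_const_def field_simps)
  qed
  then show ?thesis
    unfolding fs_d_P[OF assms] unfolding fs_P_lin fs_theta_form fs_Q_form form_simps finsum_form[OF finite]
    by (simp only: form_def)
qed

lemma grassmann_fuzzy_sphere:
  assumes "lam \<noteq> 0"
  shows "grassmann (fs_alg lam) (fs_Omega lam) (fs_const lam) (fs_d lam) (fs_P lam)"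
  by (intro grassmann.intro grassmann_axioms.intro Omega.bimod_axioms fs_d_derivation assms
      fs_P_closed fs_P_idempotent) (simp add: fs_const_def)

theorem lemma5p1:
  fixes lam :: real
  assumes "lam \<noteq> 0" and "lam \<noteq> 1" and "lam \<noteq> - 1"
  shows "(\<exists>!nabla. is_grassmann_connection lam nabla) \<and>
    (\<forall>nabla. is_grassmann_connection lam nabla \<longrightarrow>
      (\<forall>\<alpha>. nabla (fs_e lam \<alpha>) =
        (\<Oplus>\<^bsub>fs_Omega_S lam\<^esub>\<beta>\<in>UNIV.
          fs_tensor lam
            (fs_const lam (of_real ((1 + lam) / 2)) \<odot>\<^bsub>fs_Omega lam\<^esub> fs_d lam (fs_P lam \<alpha> \<beta>)
             \<oplus>\<^bsub>fs_Omega lam\<^esub>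
             fs_const lam (of_real lam) \<odot>\<^bsub>fs_Omega lam\<^esub>
               (fs_P lam \<alpha> \<beta> \<odot>\<^bsub>fs_Omega lam\<^esub> fs_theta lam)
             \<oplus>\<^bsub>fs_Omega lam\<^esub>
             fs_const lam (\<i> * of_real ((1 - lam\<^sup>2) / 4)) \<odot>\<^bsub>fs_Omega lam\<^esub> fs_Q lam \<alpha> \<beta>
             \<ominus>\<^bsub>fs_Omega lam\<^esub>
             fs_const lam (of_real (lam * (1 - lam) / 2 * (if \<alpha> = \<beta> then 1 else 0)))
               \<odot>\<^bsub>fs_Omega lam\<^esub> fs_theta lam)
            (fs_e lam \<beta>))))"
proof -
  interpret grassmann "fs_alg lam" "fs_Omega lam" "fs_const lam" "fs_d lam" "fs_P lam"
    using assms(1) by (rule grassmann_fuzzy_sphere)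
  have e: "fs_e lam \<alpha> = fs_P lam \<alpha>" for \<alpha>
    unfolding fs_e_def by (rule A.S.row_times_unit) (rule fs_P_closed)
  \<comment> \<open>Once the generators are rows of the projector, this settles existence and
    uniqueness.\<close>
  have iff: "is_grassmann_connection lam D \<longleftrightarrow> D = nabla" for D
    unfolding is_grassmann_connection_def e fs_Omega_S_def fs_tensor_def fs_S_def
    by (rule grassmann_iff)
  show ?thesis
    \<comment> \<open>Read from right to left, \<open>dP_P\<close> folds the stated forms back into
      the product of \<open>d P\<close> and \<open>P\<close>, to which \<open>nabla_row'\<close>
      applies.\<close>
    unfolding iff e fs_Omega_S_def fs_tensor_def fs_S_def dP_P[OF assms(1), symmetric]
    by (auto simp only: nabla_row')
qed

end
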